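(* Let $n\ge 4$ and let $\Gamma<\mathrm{Aut}(F_n)$ be a subgroup of finite index. Then any power of a Nielsen transformation that lies in $\Gamma$ fixes a point whenever $\Gamma$ acts by semisimple isometries on a complete $\mathrm{CAT}(0)$ space. In particular, if $\lambda_{ij}^p\in\Gamma$, then the image of $\lambda_{ij}^p$ in $H_1(\Gamma,\mathbb{Z})$ has finite order.
   Context: $F_n$ is the free group of rank $n$ with a fixed basis $\{a_1,\dots,a_n\}$. The Nielsen transformations are the automorphisms, for $i\neq j$, $\lambda_{ij}: a_i\mapsto a_ja_i,\ a_k\mapsto a_k\ (k\ne i)$ and $\rho_{ij}: a_i\mapsto a_ia_j,\ a_k\mapsto a_k\ (k\neq i)$. For an isometry $\gamma$ of a complete $\mathrm{CAT}(0)$ space $X$, put $\|\gamma\|=\inf\{d(x,\gamma.x)\mid x\in X\}$ and $\mathrm{Min}(\gamma)=\{x\in X\mid d(x,\gamma.x)=\|\gamma\|\}$. The isometry $\gamma$ is semisimple if $\mathrm{Min}(\gamma)\ne\emptyset$. An action is by semisimple isometries if every group element acts as a semisimple isometry. $H_1(\Gamma,\mathbb{Z})$ is the abelianization of $\Gamma$. *)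

theory Defs
  imports "HOL-Algebra.Group_Action" "HOL-Algebra.Generated_Groups" "HOL-Analysis.Analysis"
begin

section \<open>The free group of rank n and Nielsen transformations\<close>

text \<open>The letter \<open>(k, True)\<close> stands for the generator \<open>a\<^sub>k\<close> and \<open>(k, False)\<close> for its inverse.
  Elements of the free group are the reduced words in the letters with \<open>1 \<le> k \<le> n\<close>.\<close>

type_synonym letter = "nat \<times> bool"

definition flip :: "letter \<Rightarrow> letter" where
  "flip x = (fst x, \<not> snd x)"

definition reduced_word :: "letter list \<Rightarrow> bool" where
  "reduced_word = successively (\<lambda>x y. y \<noteq> flip x)"

fun push :: "letter \<Rightarrow> letter list \<Rightarrow> letter list" where
  "push x [] = [x]"
| "push x (y # w) = (if y = flip x then w else x # y # w)"

definition free_group :: "nat \<Rightarrow> letter list monoid" where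
  "free_group n = \<lparr>carrier = {w. set w \<subseteq> {1..n} \<times> UNIV \<and> reduced_word w},
     monoid.mult = foldr push, one = []\<rparr>"

definition basis :: "nat \<Rightarrow> letter list" where
  "basis k = [(k, True)]"

text \<open>The homomorphism out of a free group that extends a map on the basis.\<close>

definition free_ext :: "('g, 'm) monoid_scheme \<Rightarrow> (nat \<Rightarrow> 'g) \<Rightarrow> letter list \<Rightarrow> 'g" where
  "free_ext G f w =
     foldr (\<lambda>(k, e) g. (if e then f k else inv\<^bsub>G\<^esub> (f k)) \<otimes>\<^bsub>G\<^esub> g) w \<one>\<^bsub>G\<^esub>"

definition nielsen_left :: "nat \<Rightarrow> nat \<Rightarrow> nat \<Rightarrow> letter list \<Rightarrow> letter list" where
  "nielsen_left n i j = restrict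
     (free_ext (free_group n) (basis(i := basis j \<otimes>\<^bsub>free_group n\<^esub> basis i)))
     (carrier (free_group n))"

definition nielsen_right :: "nat \<Rightarrow> nat \<Rightarrow> nat \<Rightarrow> letter list \<Rightarrow> letter list" where
  "nielsen_right n i j = restrict
     (free_ext (free_group n) (basis(i := basis i \<otimes>\<^bsub>free_group n\<^esub> basis j)))
     (carrier (free_group n))"

definition nielsen_transformations :: "nat \<Rightarrow> (letter list \<Rightarrow> letter list) set" where
  "nielsen_transformations n =
     {\<nu>. \<exists>i\<in>{1..n}. \<exists>j\<in>{1..n}. i \<noteq> j \<and> (\<nu> = nielsen_left n i j \<or> \<nu> = nielsen_right n i j)}"

lemma flip_flip [simp]: "flip (flip x) = x"
  by (simp add: flip_def)

lemma flip_neq [simp]: "flip x \<noteq> x" "x \<noteq> flip x"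
  by (auto simp: flip_def prod_eq_iff)

lemma reduced_simps [simp]:
  "reduced_word []" "reduced_word [x]" "reduced_word (x # y # w) \<longleftrightarrow> y \<noteq> flip x \<and> reduced_word (y # w)"
  by (simp_all add: reduced_word_def)

lemma reduced_tl: "reduced_word (x # w) \<Longrightarrow> reduced_word w"
  by (cases w) auto

lemma reduced_push: "reduced_word w \<Longrightarrow> reduced_word (push x w)"
  by (cases w) (auto dest: reduced_tl)

lemma push_reduced: "reduced_word (x # w) \<Longrightarrow> push x w = x # w"
  by (cases w) auto

lemma push_flip: "reduced_word w \<Longrightarrow> push (flip x) (push x w) = w"
  by (cases w) (auto simp: push_reduced)

lemma push_flip': "reduced_word w \<Longrightarrow> push x (push (flip x) w) = w"
  using push_flip[of w "flip x"] by simp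

lemma set_push: "set (push x w) \<subseteq> insert x (set w)"
  by (cases w) auto

lemma reduced_foldr_push: "reduced_word w \<Longrightarrow> reduced_word (foldr push u w)"
  by (induction u) (auto intro: reduced_push)

lemma set_foldr_push: "set (foldr push u w) \<subseteq> set u \<union> set w"
proof (induction u)
  case (Cons x u)
  then show ?case using set_push[of x "foldr push u w"] by auto
qed simp

lemma foldr_push_push: "reduced_word w \<Longrightarrow> foldr push (push x u) w = push x (foldr push u w)"
  by (cases u) (auto simp: push_flip' reduced_foldr_push)

lemma foldr_push_assoc:
  "reduced_word w \<Longrightarrow> foldr push (foldr push u v) w = foldr push u (foldr push v w)"
  by (induction u) (auto simp: foldr_push_push)

lemma foldr_push_Nil: "reduced_word u \<Longrightarrow> foldr push u [] = u"
proof (induction u)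
  case (Cons x u)
  then show ?case using push_reduced[of x u] reduced_tl[of x u] by simp
qed simp

lemma foldr_push_inverse: "foldr push (rev (map flip u)) u = []"
  by (induction u) auto

lemma reduced_rev_flip: "reduced_word u \<Longrightarrow> reduced_word (rev (map flip u))"
  unfolding reduced_word_def successively_rev successively_map
  by (erule successively_mono) (auto simp: flip_def prod_eq_iff)

lemma group_free_group: "group (free_group n)"
proof (rule groupI)
  fix x assume x: "x \<in> carrier (free_group n)"
  let ?y = "rev (map flip x)"
  have "set ?y \<subseteq> {1..n} \<times> UNIV" using x by (auto simp: free_group_def flip_def)
  with x show "\<exists>y\<in>carrier (free_group n). y \<otimes>\<^bsub>free_group n\<^esub> x = \<one>\<^bsub>free_group n\<^esub>"
    by (intro bexI[of _ ?y]) (simp_all add: free_group_def foldr_push_inverse reduced_rev_flip)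
next
  fix x y assume "x \<in> carrier (free_group n)" "y \<in> carrier (free_group n)"
  then show "x \<otimes>\<^bsub>free_group n\<^esub> y \<in> carrier (free_group n)"
    using set_foldr_push[of x y] by (auto simp: free_group_def reduced_foldr_push)
qed (simp_all add: free_group_def foldr_push_assoc)

lemma basis_closed: "k \<in> {1..n} \<Longrightarrow> basis k \<in> carrier (free_group n)"
  by (simp add: free_group_def basis_def)

text \<open>The universal property: \<open>free_ext G f\<close> is the unique homomorphism extending \<open>f\<close>.\<close>

context
  fixes G :: "('g, 'm) monoid_scheme" (structure) and f :: "nat \<Rightarrow> 'g" and n :: nat
  assumes grp: "group G" and f: "\<And>k. k \<in> {1..n} \<Longrightarrow> f k \<in> carrier G"
begin

interpretation group G by (rule grp)

lemma free_ext_closed: "set w \<subseteq> {1..n} \<times> UNIV \<Longrightarrow> free_ext G f w \<in> carrier G"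
  by (induction w) (auto simp: free_ext_def f)

lemma free_ext_push:
  assumes "set (x # w) \<subseteq> {1..n} \<times> UNIV"
  shows "free_ext G f (push x w) = free_ext G f (x # w)"
proof (cases w)
  case Nil then show ?thesis by simp
next
  case (Cons y v)
  have v: "free_ext G f v \<in> carrier G" using assms Cons by (intro free_ext_closed) auto
  obtain k e where x: "x = (k, e)" by (cases x)
  have k: "f k \<in> carrier G" using assms x f by auto
  show ?thesis
    using v k by (auto simp: Cons x flip_def free_ext_def m_assoc[symmetric])
qed

lemma free_ext_hom: "free_ext G f \<in> hom (free_group n) G"
proof (rule homI)
  fix u assume "u \<in> carrier (free_group n)"
  then show "free_ext G f u \<in> carrier G" by (intro free_ext_closed) (simp add: free_group_def)
next
  fix u v assume "u \<in> carrier (free_group n)" "v \<in> carrier (free_group n)"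
  then have "set u \<subseteq> {1..n} \<times> UNIV" and v: "set v \<subseteq> {1..n} \<times> UNIV"
    by (auto simp: free_group_def)
  then have "free_ext G f (foldr push u v) = free_ext G f u \<otimes> free_ext G f v"
  proof (induction u)
    case Nil
    then show ?case using free_ext_closed[OF v] by (simp add: free_ext_def)
  next
    case (Cons x u)
    have "set (x # foldr push u v) \<subseteq> {1..n} \<times> UNIV"
      using Cons.prems set_foldr_push[of u v] by auto
    then have "free_ext G f (foldr push (x # u) v) = free_ext G f (x # foldr push u v)"
      using free_ext_push by simp
    moreover have "free_ext G f u \<in> carrier G" "free_ext G f v \<in> carrier G" "f (fst x) \<in> carrier G"
      using Cons.prems free_ext_closed f by auto
    ultimately show ?case
      using Cons by (auto simp: free_ext_def m_assoc split: prod.splits)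
  qed
  then show "free_ext G f (u \<otimes>\<^bsub>free_group n\<^esub> v) = free_ext G f u \<otimes> free_ext G f v"
    by (simp add: free_group_def)
qed

lemma free_ext_basis: "k \<in> {1..n} \<Longrightarrow> free_ext G f (basis k) = f k"
  using f by (simp add: free_ext_def basis_def)

lemma free_ext_unique:
  assumes h: "h \<in> hom (free_group n) G" and hf: "\<And>k. k \<in> {1..n} \<Longrightarrow> h (basis k) = f k"
    and w: "w \<in> carrier (free_group n)"
  shows "h w = free_ext G f w"
  using w
proof (induction w)
  case Nil
  have "h \<one>\<^bsub>free_group n\<^esub> = \<one>" using hom_one[OF h group_free_group grp] .
  then show ?case by (simp add: free_group_def free_ext_def)
next
  case (Cons x w)
  interpret F: group "free_group n" by (rule group_free_group)
  interpret H: group_hom "free_group n" G h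
    by unfold_locales (rule h)
  obtain k e where x: "x = (k, e)" by (cases x)
  have k: "k \<in> {1..n}" using Cons.prems x by (auto simp: free_group_def)
  have c: "[x] \<in> carrier (free_group n)" "w \<in> carrier (free_group n)"
    using Cons.prems by (auto simp: free_group_def dest: reduced_tl)
  have "x # w = [x] \<otimes>\<^bsub>free_group n\<^esub> w"
    using Cons.prems by (simp add: free_group_def push_reduced)
  then have "h (x # w) = h [x] \<otimes> h w" using c by simp
  moreover have "h [x] = (if e then f k else inv (f k))"
  proof (cases e)
    case True then show ?thesis using hf[OF k] x by (simp add: basis_def)
  next
    case False
    have "[x] \<otimes>\<^bsub>free_group n\<^esub> basis k = \<one>\<^bsub>free_group n\<^esub>"
      using False x by (simp add: free_group_def basis_def flip_def)
    then have "inv\<^bsub>free_group n\<^esub> (basis k) = [x]"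
      using c basis_closed[OF k] by (intro F.inv_equality)
    then show ?thesis using False H.hom_inv[OF basis_closed[OF k]] hf[OF k] by simp
  qed
  ultimately show ?case using Cons.IH[OF c(2)] x by (simp add: free_ext_def)
qed

end

lemma free_ext_auto:
  assumes f: "\<And>k. k \<in> {1..n} \<Longrightarrow> f k \<in> carrier (free_group n)"
    and g: "\<And>k. k \<in> {1..n} \<Longrightarrow> g k \<in> carrier (free_group n)"
    and fg: "\<And>k. k \<in> {1..n} \<Longrightarrow> free_ext (free_group n) f (g k) = basis k"
    and gf: "\<And>k. k \<in> {1..n} \<Longrightarrow> free_ext (free_group n) g (f k) = basis k"
  shows "restrict (free_ext (free_group n) f) (carrier (free_group n)) \<in> auto (free_group n)"
proof -
  let ?F = "free_group n"
  note grp = group_free_group[of n]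
  have f': "free_ext ?F f \<in> hom ?F ?F" and g': "free_ext ?F g \<in> hom ?F ?F"
    using free_ext_hom[OF grp] f g by blast+
  have fb: "free_ext ?F f (basis k) = f k" "free_ext ?F g (basis k) = g k" if "k \<in> {1..n}" for k
    by (rule free_ext_basis[OF grp _ that], rule f g, assumption)+
  have id: "p w = w" if "p \<in> hom ?F ?F" "\<And>k. k \<in> {1..n} \<Longrightarrow> p (basis k) = basis k"
    "w \<in> carrier ?F" for p w
  proof -
    have "p w = free_ext ?F basis w"
      using free_ext_unique[OF grp basis_closed that(1,2,3)] .
    moreover have "(\<lambda>x. x) w = free_ext ?F basis w"
      by (rule free_ext_unique[OF grp basis_closed]) (auto simp: that hom_def)
    ultimately show ?thesis by simp
  qed
  have "(free_ext ?F f \<circ> free_ext ?F g) w = w" if "w \<in> carrier ?F" for w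
    by (rule id[OF Group.hom_compose[OF g' f'] _ that])
      (simp only: o_apply fg fb)
  moreover have "(free_ext ?F g \<circ> free_ext ?F f) w = w" if "w \<in> carrier ?F" for w
    by (rule id[OF Group.hom_compose[OF f' g'] _ that])
      (simp only: o_apply gf fb)
  ultimately have "bij_betw (free_ext ?F f) (carrier ?F) (carrier ?F)"
    using hom_carrier[OF f'] hom_carrier[OF g']
    by (intro bij_betw_byWitness[where f' = "free_ext ?F g"]) (unfold o_apply, blast+)
  then have "bij_betw (restrict (free_ext ?F f) (carrier ?F)) (carrier ?F) (carrier ?F)"
    by (simp only: bij_betw_restrict_eq)
  moreover have "restrict (free_ext ?F f) (carrier ?F) \<in> hom ?F ?F"
    by (rule group.hom_restrict[OF grp f']) simp
  ultimately show ?thesis by (simp add: auto_def Bij_def)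
qed

lemma nielsen_transformations_auto: "nielsen_transformations n \<subseteq> auto (free_group n)"
proof -
  let ?F = "free_group n"
  interpret F: group ?F by (rule group_free_group)
  have aut: "restrict (free_ext ?F (basis(i := c))) (carrier ?F) \<in> auto ?F"
    if c: "c \<in> carrier ?F" "d \<in> carrier ?F"
      and e: "free_ext ?F (basis(i := c)) d = basis i" "free_ext ?F (basis(i := d)) c = basis i" for i c d
  proof (rule free_ext_auto[where g = "basis(i := d)"])
    show "(basis(i := c)) k \<in> carrier ?F" "(basis(i := d)) k \<in> carrier ?F" if "k \<in> {1..n}" for k
      using that c by (simp_all add: basis_closed)
    fix k assume k: "k \<in> {1..n}"
    show "free_ext ?F (basis(i := c)) ((basis(i := d)) k) = basis k"
    proof (cases "k = i")
      case False
      have "free_ext ?F (basis(i := c)) (basis k) = (basis(i := c)) k"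
        by (rule free_ext_basis[OF F.group_axioms _ k]) (simp add: basis_closed c)
      with False show ?thesis by simp
    qed (simp add: e)
    show "free_ext ?F (basis(i := d)) ((basis(i := c)) k) = basis k"
    proof (cases "k = i")
      case False
      have "free_ext ?F (basis(i := d)) (basis k) = (basis(i := d)) k"
        by (rule free_ext_basis[OF F.group_axioms _ k]) (simp add: basis_closed c)
      with False show ?thesis by simp
    qed (simp add: e)
  qed
  have "nielsen_left n i j \<in> auto ?F \<and> nielsen_right n i j \<in> auto ?F"
    if ij: "i \<in> {1..n}" "j \<in> {1..n}" "i \<noteq> j" for i j
  proof -
    note b = basis_closed[OF ij(1)] basis_closed[OF ij(2)]
    have H: "group_hom ?F ?F (free_ext ?F (basis(i := c)))" if "c \<in> carrier ?F" for c
      using free_ext_hom[OF F.group_axioms, of n "basis(i := c)"] that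
      by (auto simp: group_hom_def group_hom_axioms_def basis_closed)
    have E: "free_ext ?F (basis(i := c)) (basis i) = c"
      "free_ext ?F (basis(i := c)) (basis j) = basis j" if "c \<in> carrier ?F" for c
      using free_ext_basis[OF F.group_axioms, of n "basis(i := c)"] that ij
      by (auto simp: basis_closed)
    have step: "free_ext ?F (basis(i := c)) (basis j \<otimes>\<^bsub>?F\<^esub> basis i) = basis j \<otimes>\<^bsub>?F\<^esub> c \<and>
      free_ext ?F (basis(i := c)) (inv\<^bsub>?F\<^esub> (basis j) \<otimes>\<^bsub>?F\<^esub> basis i) = inv\<^bsub>?F\<^esub> (basis j) \<otimes>\<^bsub>?F\<^esub> c \<and>
      free_ext ?F (basis(i := c)) (basis i \<otimes>\<^bsub>?F\<^esub> basis j) = c \<otimes>\<^bsub>?F\<^esub> basis j \<and>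
      free_ext ?F (basis(i := c)) (basis i \<otimes>\<^bsub>?F\<^esub> inv\<^bsub>?F\<^esub> (basis j)) = c \<otimes>\<^bsub>?F\<^esub> inv\<^bsub>?F\<^esub> (basis j)"
      if c: "c \<in> carrier ?F" for c
    proof -
      note hom = group_hom.hom_mult[OF H[OF c]] group_hom.hom_inv[OF H[OF c]]
      show ?thesis
        by (simp only: hom b F.inv_closed E[OF c] simp_thms)
    qed
    have "nielsen_left n i j \<in> auto ?F" unfolding nielsen_left_def
    proof (rule aut[where d = "inv\<^bsub>?F\<^esub> (basis j) \<otimes>\<^bsub>?F\<^esub> basis i"])
      show "free_ext ?F (basis(i := basis j \<otimes>\<^bsub>?F\<^esub> basis i)) (inv\<^bsub>?F\<^esub> (basis j) \<otimes>\<^bsub>?F\<^esub> basis i) = basis i"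
        using step[of "basis j \<otimes>\<^bsub>?F\<^esub> basis i"] b
        by (simp only: F.m_closed F.inv_closed F.m_assoc[symmetric] F.l_inv F.l_one)
      show "free_ext ?F (basis(i := inv\<^bsub>?F\<^esub> (basis j) \<otimes>\<^bsub>?F\<^esub> basis i)) (basis j \<otimes>\<^bsub>?F\<^esub> basis i) = basis i"
        using step[of "inv\<^bsub>?F\<^esub> (basis j) \<otimes>\<^bsub>?F\<^esub> basis i"] b
        by (simp only: F.m_closed F.inv_closed F.m_assoc[symmetric] F.r_inv F.l_one)
    qed (intro F.m_closed F.inv_closed b)+
    moreover have "nielsen_right n i j \<in> auto ?F" unfolding nielsen_right_def
    proof (rule aut[where d = "basis i \<otimes>\<^bsub>?F\<^esub> inv\<^bsub>?F\<^esub> (basis j)"])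
      show "free_ext ?F (basis(i := basis i \<otimes>\<^bsub>?F\<^esub> basis j)) (basis i \<otimes>\<^bsub>?F\<^esub> inv\<^bsub>?F\<^esub> (basis j)) = basis i"
        using step[of "basis i \<otimes>\<^bsub>?F\<^esub> basis j"] b
        by (simp only: F.m_closed F.inv_closed F.m_assoc F.r_inv F.r_one)
      show "free_ext ?F (basis(i := basis i \<otimes>\<^bsub>?F\<^esub> inv\<^bsub>?F\<^esub> (basis j))) (basis i \<otimes>\<^bsub>?F\<^esub> basis j) = basis i"
        using step[of "basis i \<otimes>\<^bsub>?F\<^esub> inv\<^bsub>?F\<^esub> (basis j)"] b
        by (simp only: F.m_closed F.inv_closed F.m_assoc F.l_inv F.r_one)
    qed (intro F.m_closed F.inv_closed b)+
    ultimately show ?thesis ..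
  qed
  then show ?thesis by (auto simp: nielsen_transformations_def)
qed

section \<open>Abelianization\<close>

definition abelianization :: "('g, 'm) monoid_scheme \<Rightarrow> 'g set monoid" where
  "abelianization G = G Mod derived G (carrier G)"

definition abelianization_map :: "('g, 'm) monoid_scheme \<Rightarrow> 'g \<Rightarrow> 'g set" where
  "abelianization_map G g = derived G (carrier G) #>\<^bsub>G\<^esub> g"

definition finite_order :: "('g, 'm) monoid_scheme \<Rightarrow> 'g \<Rightarrow> bool" where
  "finite_order G g \<longleftrightarrow> (\<exists>m::nat. m > 0 \<and> g [^]\<^bsub>G\<^esub> m = \<one>\<^bsub>G\<^esub>)"

section \<open>CAT(0) spaces\<close>

definition geodesic_segment :: "'a::metric_space set \<Rightarrow> 'a \<Rightarrow> 'a \<Rightarrow> bool" where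
  "geodesic_segment S p q \<longleftrightarrow>
     (\<exists>(c :: real \<Rightarrow> 'a) l. 0 \<le> l \<and> c 0 = p \<and> c l = q \<and> S = c ` {0..l} \<and>
        (\<forall>s\<in>{0..l}. \<forall>t\<in>{0..l}. dist (c s) (c t) = \<bar>s - t\<bar>))"

definition comparison_on_side ::
  "'a::metric_space set \<Rightarrow> 'a \<Rightarrow> real^2 \<Rightarrow> real^2 \<Rightarrow> 'a \<Rightarrow> real^2 \<Rightarrow> bool" where
  "comparison_on_side S p p' q' x x' \<longleftrightarrow>
     x \<in> S \<and> x' \<in> closed_segment p' q' \<and> dist p' x' = dist p x"

text \<open>\<open>X\<close> is the whole type: it is geodesic, and for every geodesic triangle with vertices
  \<open>p, q, r\<close> and sides \<open>A = [p,q]\<close>, \<open>B = [q,r]\<close>, \<open>C = [r,p]\<close>, and every comparison triangle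
  \<open>p', q', r'\<close> in the Euclidean plane, all points \<open>x, y\<close> of the triangle are at most as far
  apart as their comparison points.\<close>

definition CAT0 :: "'a::metric_space itself \<Rightarrow> bool" where
  "CAT0 (X :: 'a itself) \<longleftrightarrow>
     (\<forall>p q :: 'a. \<exists>S. geodesic_segment S p q) \<and>
     (\<forall>(p :: 'a) q r A B C p' q' r' x y x' y'.
        geodesic_segment A p q \<and> geodesic_segment B q r \<and> geodesic_segment C r p \<and>
        dist p' q' = dist p q \<and> dist q' r' = dist q r \<and> dist r' p' = dist r p \<and>
        (comparison_on_side A p p' q' x x' \<or> comparison_on_side B q q' r' x x' \<or>
         comparison_on_side C r r' p' x x') \<and>
        (comparison_on_side A p p' q' y y' \<or> comparison_on_side B q q' r' y y' \<or>
         comparison_on_side C r r' p' y y')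
        \<longrightarrow> dist x y \<le> dist x' y')"

section \<open>Semisimple isometries\<close>

definition isometry :: "('a::metric_space \<Rightarrow> 'a) \<Rightarrow> bool" where
  "isometry \<gamma> \<longleftrightarrow> bij \<gamma> \<and> (\<forall>x y. dist (\<gamma> x) (\<gamma> y) = dist x y)"

definition translation_length :: "('a::metric_space \<Rightarrow> 'a) \<Rightarrow> real" where
  "translation_length \<gamma> = (INF x. dist x (\<gamma> x))"

definition Min_set :: "('a::metric_space \<Rightarrow> 'a) \<Rightarrow> 'a set" where
  "Min_set \<gamma> = {x. dist x (\<gamma> x) = translation_length \<gamma>}"

definition semisimple :: "('a::metric_space \<Rightarrow> 'a) \<Rightarrow> bool" where
  "semisimple \<gamma> \<longleftrightarrow> isometry \<gamma> \<and> Min_set \<gamma> \<noteq> {}"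

end

theory Submission
  imports Defs "HOL-Real_Asymp.Real_Asymp"
begin

text \<open>A Nielsen transformation is shown to move points sublinearly whenever a subgroup of finite index
acts on a CAT(0) space; an isometry that is semisimple and moves points sublinearly has a fixed
point, and for the abelianisation one lets \<open>\<Gamma>\<close> act by translations of the real line through a
character, which has to vanish on the element.

Inducing the action of \<open>\<Gamma>\<close> gives an action of the whole group \<open>Aut(F\<^sub>n)\<close> on a finite product
(\<open>induced_kernel\<close>), so exact relations between Nielsen transformations become available. Only the
squared distances along one orbit matter, and of these only the four-point inequality of
\<open>round_kernel\<close>. It implies (\<open>parallelogram\<close>) that the squared asymptotic speed of commuting elements
obeys the parallelogram law. The resulting form \<open>\<langle>g, h\<rangle>\<close> on commuting pairs is, for fixed
\<open>g\<close>, a homomorphism on the centraliser of \<open>g\<close>, commutative or not (\<open>form_add\<close>): up to scaling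
it is the Busemann character of the axis of \<open>g\<close>. Hence \<open>\<langle>g, z\<rangle> = 0\<close> whenever \<open>z\<close> is a commutator of elements
that commute with \<open>g\<close>.

Fix \<open>i \<noteq> j\<close> and write \<open>\<lambda>\<^sub>k, \<rho>\<^sub>k\<close> for the two Nielsen transformations that multiply \<open>a\<^sub>k\<close> by \<open>a\<^sub>j\<close>, and
\<open>ad\<close> for conjugation by \<open>a\<^sub>j\<close>. These commute with each other, and
\<open>ad \<cdot> \<Prod>\<^sub>k \<rho>\<^sub>k = \<Prod>\<^sub>k \<lambda>\<^sub>k\<close>. Commutator relations inside centralisers give
\<open>\<langle>\<lambda>\<^sub>i, \<rho>\<^sub>k\<rangle> = 0\<close> for all \<open>k\<close> and \<open>\<langle>\<lambda>\<^sub>i, \<lambda>\<^sub>k\<rangle> = 0\<close> for \<open>k \<noteq> i\<close>; here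
\<open>n \<ge> 4\<close> leaves room for a fourth index. So
\<open>\<langle>\<lambda>\<^sub>i, ad\<rangle> = \<langle>\<lambda>\<^sub>i, \<lambda>\<^sub>i\<rangle>\<close>. But \<open>\<lambda>\<^sub>i\<close> is also a commutator of
elements fixing \<open>a\<^sub>j\<close>, which commute with \<open>ad\<close>, so \<open>\<langle>ad, \<lambda>\<^sub>i\<rangle> = 0\<close>. By symmetry of the form
\<open>\<lambda>\<^sub>i\<close> has speed zero (\<open>nielsen_drift_zero\<close>).\<close>

section \<open>Asymptotic speed of commuting elements\<close>

lemma (in group) cancel_inv_left: "\<lbrakk>g \<in> carrier G; h \<in> carrier G\<rbrakk> \<Longrightarrow> inv g \<otimes> (g \<otimes> h) = h"
  and cancel_left_inv: "\<lbrakk>g \<in> carrier G; h \<in> carrier G\<rbrakk> \<Longrightarrow> g \<otimes> (inv g \<otimes> h) = h"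
  by (simp_all add: m_assoc[symmetric])

lemma (in group) inv_commute:
  assumes "g \<in> carrier G" "h \<in> carrier G" "g \<otimes> h = h \<otimes> g"
  shows "inv g \<otimes> h = h \<otimes> inv g"
proof -
  have "h \<otimes> inv g = inv g \<otimes> (g \<otimes> h) \<otimes> inv g" using assms(1,2) by (simp add: cancel_inv_left)
  also have "\<dots> = inv g \<otimes> h" unfolding assms(3) using assms(1,2) by (simp add: m_assoc)
  finally show ?thesis by simp
qed

text \<open>The kernel \<open>S a b\<close> stands for the squared distance between the translates of a base point by
\<open>a\<close> and \<open>b\<close>. The last axiom says that the squared diagonals of a quadrilateral sum to at most the
sum of the squared sides. It is the only trace of nonpositive curvature that is kept, and it is
linear in \<open>S\<close>, so it survives the summation that replaces an action of a subgroup by the induced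
action of the whole group.\<close>
locale round_kernel = group G for G (structure) +
  fixes S :: "'a \<Rightarrow> 'a \<Rightarrow> real"
  assumes S_nonneg: "\<lbrakk>a \<in> carrier G; b \<in> carrier G\<rbrakk> \<Longrightarrow> 0 \<le> S a b"
    and S_refl: "a \<in> carrier G \<Longrightarrow> S a a = 0"
    and S_sym: "\<lbrakk>a \<in> carrier G; b \<in> carrier G\<rbrakk> \<Longrightarrow> S a b = S b a"
    and S_left: "\<lbrakk>c \<in> carrier G; a \<in> carrier G; b \<in> carrier G\<rbrakk> \<Longrightarrow> S (c \<otimes> a) (c \<otimes> b) = S a b"
    and S_round: "\<lbrakk>p \<in> carrier G; q \<in> carrier G; r \<in> carrier G; s \<in> carrier G\<rbrakk>
      \<Longrightarrow> S p r + S q s \<le> S p q + S q r + S r s + S s p"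
begin

text \<open>The square of the asymptotic speed of the powers of \<open>g\<close>. Restricting to exponents \<open>2 ^ j\<close> makes the
sequence monotone, hence convergent.\<close>
definition drift :: "'a \<Rightarrow> real" where
  "drift g = lim (\<lambda>j. S \<one> (g [^] (2 ^ j :: nat)) / 4 ^ j)"

text \<open>The polarisation of the squared speed. It is meaningful for commuting pairs, where it plays the role
of the inner product of two commuting translations of a flat.\<close>
definition form :: "'a \<Rightarrow> 'a \<Rightarrow> real" where
  "form g h = (drift (g \<otimes> h) - drift g - drift h) / 2"

lemma S_shift: "\<lbrakk>g \<in> carrier G; h \<in> carrier G\<rbrakk> \<Longrightarrow> S g (g \<otimes> h) = S \<one> h"
  using S_left[of g \<one> h] by simp

lemma S_double:
  assumes g: "g \<in> carrier G"
  shows "S \<one> (g \<otimes> g) \<le> 4 * S \<one> g"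
  using S_round[of \<one> g "g \<otimes> g" g] S_shift[OF g g] S_sym[of g \<one>] S_sym[of "g \<otimes> g" g] S_refl[of g] g
  by simp

lemma pow_double: "g \<in> carrier G \<Longrightarrow> g [^] (2 ^ Suc j :: nat) = g [^] (2 ^ j :: nat) \<otimes> g [^] (2 ^ j :: nat)"
  by (simp add: nat_pow_mult mult_2)

lemma drift_seq:
  assumes g: "g \<in> carrier G"
  shows drift_lim: "(\<lambda>j. S \<one> (g [^] (2 ^ j :: nat)) / 4 ^ j) \<longlonglongrightarrow> drift g"
    and drift_le: "drift g \<le> S \<one> g"
    and drift_nonneg: "0 \<le> drift g"
    and S_pow_le: "S \<one> (g [^] (2 ^ j :: nat)) \<le> 4 ^ j * S \<one> g"
proof -
  let ?X = "\<lambda>j. S \<one> (g [^] (2 ^ j :: nat)) / 4 ^ j"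
  have dec: "decseq ?X"
  proof (rule decseq_SucI)
    fix j
    have "S \<one> (g [^] (2 ^ Suc j :: nat)) \<le> 4 * S \<one> (g [^] (2 ^ j :: nat))"
      using S_double[of "g [^] (2 ^ j :: nat)"] g unfolding pow_double[OF g] by simp
    then show "?X (Suc j) \<le> ?X j" by (simp add: field_simps)
  qed
  have pos: "0 \<le> ?X j" for j using g by (simp add: S_nonneg)
  obtain L where L: "?X \<longlonglongrightarrow> L" "\<And>i. L \<le> ?X i"
    using decseq_convergent[OF dec, of 0] pos by blast
  have QL: "drift g = L" unfolding drift_def by (rule limI[OF L(1)])
  show "?X \<longlonglongrightarrow> drift g" using L QL by simp
  show "drift g \<le> S \<one> g" using L(2)[of 0] QL g by simp
  show "0 \<le> drift g" unfolding QL by (rule LIMSEQ_le_const[OF L(1)]) (use pos in blast)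
  have "?X j \<le> ?X 0" using decseqD[OF dec, of 0 j] by blast
  then show "S \<one> (g [^] (2 ^ j :: nat)) \<le> 4 ^ j * S \<one> g" using g by (simp add: field_simps)
qed

lemma drift_inv:
  assumes g: "g \<in> carrier G"
  shows "drift (inv g) = drift g"
proof -
  have "S \<one> (inv g [^] k) = S \<one> (g [^] k)" for k :: nat
  proof -
    have "S \<one> (inv g [^] k) = S (g [^] k \<otimes> \<one>) (g [^] k \<otimes> inv g [^] k)"
      by (rule S_left[symmetric]) (use g in auto)
    also have "g [^] k \<otimes> inv g [^] k = \<one>" using g by (simp add: nat_pow_inv)
    finally show ?thesis using g by (simp add: S_sym)
  qed
  then show ?thesis unfolding drift_def by simp
qed

lemma drift_sq:
  assumes g: "g \<in> carrier G"
  shows "drift (g \<otimes> g) = 4 * drift g"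
proof -
  have "(\<lambda>j. 4 * (S \<one> (g [^] (2 ^ Suc j :: nat)) / 4 ^ Suc j)) \<longlonglongrightarrow> 4 * drift g"
    by (intro tendsto_mult tendsto_const LIMSEQ_Suc[OF drift_lim[OF g]])
  moreover have "g [^] (2 ^ Suc j :: nat) = (g \<otimes> g) [^] (2 ^ j :: nat)" for j
    unfolding pow_double[OF g] using g by (simp add: pow_mult_distrib)
  ultimately have "(\<lambda>j. S \<one> ((g \<otimes> g) [^] (2 ^ j :: nat)) / 4 ^ j) \<longlonglongrightarrow> 4 * drift g"
    by simp
  then show ?thesis using drift_lim[of "g \<otimes> g"] g LIMSEQ_unique by blast
qed

text \<open>The quadrilateral with vertices \<open>1, g ^ k, g ^ k h ^ k, h ^ k\<close> has opposite sides of equal length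
because \<open>g\<close> and \<open>h\<close> commute; divide its four-point inequality by \<open>k\<^sup>2\<close>.\<close>
lemma parallelogram_le:
  assumes g: "g \<in> carrier G" and h: "h \<in> carrier G" and c: "g \<otimes> h = h \<otimes> g"
  shows "drift (g \<otimes> h) + drift (inv g \<otimes> h) \<le> 2 * drift g + 2 * drift h"
proof -
  note ci = inv_commute[OF assms]
  have step: "S \<one> ((g \<otimes> h) [^] k) + S \<one> ((inv g \<otimes> h) [^] k) \<le> 2 * S \<one> (g [^] k) + 2 * S \<one> (h [^] k)"
    for k :: nat
  proof -
    let ?a = "g [^] k" and ?b = "h [^] k"
    have ab: "?a \<in> carrier G" "?b \<in> carrier G" using g h by auto
    have comm: "?a \<otimes> ?b = ?b \<otimes> ?a"
      using c g h by (metis group_commutes_pow nat_pow_closed)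
    have "S \<one> (?a \<otimes> ?b) + S ?a ?b \<le> S \<one> ?a + S ?a (?a \<otimes> ?b) + S (?a \<otimes> ?b) ?b + S ?b \<one>"
      using S_round[of \<one> ?a "?a \<otimes> ?b" ?b] ab by simp
    moreover have "S ?a (?a \<otimes> ?b) = S \<one> ?b" using S_shift ab by blast
    moreover have "S (?a \<otimes> ?b) ?b = S \<one> ?a"
      unfolding comm using S_shift[of ?b ?a] S_sym[of ?b "?b \<otimes> ?a"] ab by simp
    moreover have "S ?b \<one> = S \<one> ?b" using S_sym ab by simp
    moreover have "(g \<otimes> h) [^] k = ?a \<otimes> ?b" using pow_mult_distrib[OF c g h] .
    moreover have "S ?a ?b = S \<one> ((inv g \<otimes> h) [^] k)"
    proof -
      have "(inv g \<otimes> h) [^] k = inv ?a \<otimes> ?b"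
        using pow_mult_distrib[OF ci] g h by (simp add: nat_pow_inv)
      then have "S \<one> ((inv g \<otimes> h) [^] k) = S (?a \<otimes> \<one>) (?a \<otimes> (inv ?a \<otimes> ?b))"
        using S_left[of ?a \<one> "inv ?a \<otimes> ?b"] ab by simp
      then show ?thesis using ab by (simp add: m_assoc[symmetric])
    qed
    ultimately show ?thesis by simp
  qed
  have "(\<lambda>j. S \<one> ((g \<otimes> h) [^] (2 ^ j :: nat)) / 4 ^ j + S \<one> ((inv g \<otimes> h) [^] (2 ^ j :: nat)) / 4 ^ j)
      \<longlonglongrightarrow> drift (g \<otimes> h) + drift (inv g \<otimes> h)"
    by (intro tendsto_add drift_lim) (use g h in auto)
  moreover have "(\<lambda>j. 2 * (S \<one> (g [^] (2 ^ j :: nat)) / 4 ^ j) + 2 * (S \<one> (h [^] (2 ^ j :: nat)) / 4 ^ j))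
      \<longlonglongrightarrow> 2 * drift g + 2 * drift h"
    by (intro tendsto_add tendsto_mult tendsto_const drift_lim g h)
  ultimately show ?thesis
  proof (rule LIMSEQ_le)
    show "\<exists>N. \<forall>j\<ge>N. S \<one> ((g \<otimes> h) [^] (2 ^ j :: nat)) / 4 ^ j + S \<one> ((inv g \<otimes> h) [^] (2 ^ j :: nat)) / 4 ^ j
      \<le> 2 * (S \<one> (g [^] (2 ^ j :: nat)) / 4 ^ j) + 2 * (S \<one> (h [^] (2 ^ j :: nat)) / 4 ^ j)"
      using step by (auto simp: add_divide_distrib[symmetric] divide_right_mono)
  qed
qed

text \<open>The reverse inequality is the same inequality for the pair \<open>inv g \<otimes> h\<close>, \<open>g \<otimes> h\<close>, whose product and
quotient are \<open>h\<^sup>2\<close> and \<open>g\<^sup>2\<close>, with four times the drift. So no flat has to be found in the space.\<close>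
lemma parallelogram:
  assumes g: "g \<in> carrier G" and h: "h \<in> carrier G" and c: "g \<otimes> h = h \<otimes> g"
  shows "drift (g \<otimes> h) + drift (inv g \<otimes> h) = 2 * drift g + 2 * drift h"
proof (rule antisym[OF parallelogram_le[OF assms]])
  let ?x = "inv g \<otimes> h" and ?y = "g \<otimes> h"
  note ci = inv_commute[OF assms]
  have xy: "?x \<otimes> ?y = h \<otimes> h"
    unfolding ci using g h by (simp add: m_assoc cancel_inv_left)
  have yx: "?y \<otimes> ?x = h \<otimes> h"
    unfolding c using g h by (simp add: m_assoc cancel_left_inv)
  have ix: "inv ?x \<otimes> ?y = g \<otimes> g"
    unfolding c using g h by (simp add: inv_mult_group m_assoc cancel_inv_left) (simp add: c m_assoc[symmetric])?
  show "2 * drift g + 2 * drift h \<le> drift (g \<otimes> h) + drift (inv g \<otimes> h)"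
    using parallelogram_le[of ?x ?y] xy yx ix drift_sq[OF g] drift_sq[OF h] g h by simp
qed

lemma form_sym: "g \<otimes> h = h \<otimes> g \<Longrightarrow> form g h = form h g"
  by (simp add: form_def)

lemma drift_one: "drift \<one> = 0"
  using drift_le[of \<one>] drift_nonneg[of \<one>] S_refl[of \<one>] by simp

lemma form_self: "g \<in> carrier G \<Longrightarrow> form g g = drift g"
  by (simp add: form_def drift_sq)

lemma form_inv_right:
  assumes "g \<in> carrier G" "h \<in> carrier G" "g \<otimes> h = h \<otimes> g"
  shows "form g (inv h) = - form g h"
proof -
  have "inv (g \<otimes> inv h) = inv g \<otimes> h"
    using assms inv_commute[OF assms] by (simp add: inv_mult_group)
  then have "drift (g \<otimes> inv h) = drift (inv g \<otimes> h)" using drift_inv[of "g \<otimes> inv h"] assms by simp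
  then show ?thesis using parallelogram[OF assms] drift_inv[of h] assms by (simp add: form_def field_simps)
qed

lemma form_double:
  assumes g: "g \<in> carrier G" and h: "h \<in> carrier G" and c: "g \<otimes> h = h \<otimes> g"
  shows "form (g \<otimes> g) h = 2 * form g h"
proof -
  have "g \<otimes> (g \<otimes> h) = g \<otimes> h \<otimes> g" using g h by (simp add: c[symmetric] m_assoc)
  then have "drift (g \<otimes> (g \<otimes> h)) + drift (inv g \<otimes> (g \<otimes> h)) = 2 * drift g + 2 * drift (g \<otimes> h)"
    using parallelogram[of g "g \<otimes> h"] g h by simp
  then show ?thesis using g h by (simp add: form_def drift_sq m_assoc[symmetric])
qed

lemma form_pow_left:
  assumes "g \<in> carrier G" "h \<in> carrier G" "g \<otimes> h = h \<otimes> g"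
  shows "form (g [^] (2 ^ j :: nat)) h = 2 ^ j * form g h"
proof (induction j)
  case (Suc j)
  have "g [^] (2 ^ j :: nat) \<otimes> h = h \<otimes> g [^] (2 ^ j :: nat)"
    using assms by (metis group_commutes_pow)
  then show ?case using form_double[of "g [^] (2 ^ j :: nat)" h] Suc assms unfolding pow_double[OF assms(1)]
    by simp
qed (use assms in simp)

lemma drift_pow2: "g \<in> carrier G \<Longrightarrow> drift (g [^] (2 ^ j :: nat)) = 4 ^ j * drift g"
proof (induction j)
  case (Suc j)
  then show ?case using drift_sq[of "g [^] (2 ^ j :: nat)"] unfolding pow_double[OF Suc.prems] by simp
qed simp

text \<open>The inner product of the vectors \<open>pq\<close> and \<open>rs\<close>, written in terms of squared distances. It is additive
in each vector in any space; the four-point inequality bounds it.\<close>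
definition ip :: "'a \<Rightarrow> 'a \<Rightarrow> 'a \<Rightarrow> 'a \<Rightarrow> real" where
  "ip p q r s = (S p s + S q r - S p r - S q s) / 2"

lemma ip_bound:
  assumes "p \<in> carrier G" "q \<in> carrier G" "r \<in> carrier G" "s \<in> carrier G"
  shows "\<bar>ip p q r s\<bar> \<le> (S p q + S r s) / 2"
proof -
  have "S p s + S q r \<le> S p q + S q s + S s r + S r p" "S p r + S q s \<le> S p q + S q r + S r s + S s p"
    using S_round[of p q s r] S_round[of p q r s] assms by auto
  moreover have "S s r = S r s" "S r p = S p r" "S s p = S p s"
    using S_sym assms by auto
  ultimately show ?thesis by (simp add: ip_def abs_le_iff field_simps)
qed

lemma ip_left:
  assumes "x \<in> carrier G" "p \<in> carrier G" "q \<in> carrier G" "r \<in> carrier G" "s \<in> carrier G"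
  shows "ip (x \<otimes> p) (x \<otimes> q) (x \<otimes> r) (x \<otimes> s) = ip p q r s"
  using assms by (simp add: ip_def S_left)

text \<open>How far \<open>h\<close> moves the base point in the direction of \<open>g ^ k\<close>; divided by \<open>k\<close> this tends to a multiple of
the Busemann character of the axis of \<open>g\<close>.\<close>
definition progress :: "'a \<Rightarrow> nat \<Rightarrow> 'a \<Rightarrow> real" where
  "progress g k h = ip \<one> h \<one> (g [^] k)"

lemma progress_split:
  assumes g: "g \<in> carrier G" and h: "h \<in> carrier G" "h' \<in> carrier G" and c: "g \<otimes> h = h \<otimes> g"
  shows "progress g k (h \<otimes> h') - progress g k h - progress g k h' =
    ip h (h \<otimes> h') \<one> h + ip h (h \<otimes> h') (g [^] k \<otimes> h) (g [^] k)"
proof -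
  have comm: "g [^] k \<otimes> h = h \<otimes> g [^] k" using g h c by (metis group_commutes_pow)
  have "progress g k h' = ip h (h \<otimes> h') h (g [^] k \<otimes> h)"
    unfolding comm progress_def using ip_left[of h \<one> h' \<one> "g [^] k"] g h by simp
  moreover have "S h \<one> = S \<one> h" "S \<one> \<one> = 0" using S_sym S_refl h by auto
  ultimately show ?thesis using g h by (simp add: progress_def ip_def field_simps)
qed

text \<open>For \<open>h\<close> commuting with \<open>g\<close> the defect of additivity is bounded independently of \<open>k\<close>: moving
the direction \<open>g ^ k\<close> by \<open>h\<close> changes both of its ends by a bounded amount. Here
\<open>h\<close> and \<open>h'\<close> may fail to commute with each other, which makes the limit a homomorphism on the whole
centraliser.\<close>
lemma progress_add_bound:
  assumes g: "g \<in> carrier G" and h: "h \<in> carrier G" "h' \<in> carrier G" and c: "g \<otimes> h = h \<otimes> g"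
  shows "\<bar>progress g k (h \<otimes> h') - progress g k h - progress g k h'\<bar> \<le> S \<one> h + S \<one> h'"
proof -
  have "S h (h \<otimes> h') = S \<one> h'" "S (g [^] k \<otimes> h) (g [^] k) = S \<one> h"
    using S_shift[of h h'] S_shift[of "g [^] k" h] S_sym[of "g [^] k" "g [^] k \<otimes> h"] g h by auto
  then show ?thesis
    using ip_bound[of h "h \<otimes> h'" \<one> h] ip_bound[of h "h \<otimes> h'" "g [^] k \<otimes> h" "g [^] k"] g h
    unfolding progress_split[OF assms] by simp
qed

text \<open>A vector from \<open>x\<close> to \<open>x h ^ s\<close> is cut into \<open>s\<close> steps. Bounding the steps one at a time gives a
bound linear in \<open>s\<close>, whereas \<open>ip_bound\<close> applied to the whole vector is quadratic in \<open>s\<close>, which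
would be too weak for \<open>progress_pow_bound\<close>.\<close>
lemma ip_chain:
  assumes "p \<in> carrier G" "q \<in> carrier G" "x \<in> carrier G" and h: "h \<in> carrier G"
    and pq: "S p q \<le> S \<one> h"
  shows "\<bar>ip p q x (x \<otimes> h [^] (s::nat))\<bar> \<le> s * S \<one> h"
proof (induction s)
  case 0
  then show ?case using assms by (simp add: ip_def)
next
  case (Suc s)
  let ?y = "x \<otimes> h [^] s"
  have y: "x \<otimes> h [^] Suc s = ?y \<otimes> h" using assms by (simp add: m_assoc)
  have "ip p q x (?y \<otimes> h) = ip p q x ?y + ip p q ?y (?y \<otimes> h)"
    by (simp add: ip_def field_simps)
  moreover have "\<bar>ip p q ?y (?y \<otimes> h)\<bar> \<le> S \<one> h"
    using ip_bound[of p q ?y "?y \<otimes> h"] S_shift[of ?y h] assms by simp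
  ultimately show ?case using Suc unfolding y by (simp add: algebra_simps)
qed

lemma progress_pow_bound:
  assumes g: "g \<in> carrier G" and h: "h \<in> carrier G" and c: "g \<otimes> h = h \<otimes> g"
  shows "\<bar>progress g k (h [^] (m::nat)) - m * progress g k h\<bar> \<le> real m ^ 2 * S \<one> h"
proof (induction m)
  case 0
  then show ?case using g S_refl by (simp add: progress_def ip_def)
next
  case (Suc m)
  let ?h = "h [^] m" and ?a = "g [^] k"
  have hm: "?h \<in> carrier G" "?a \<in> carrier G" using g h by auto
  have cm: "g \<otimes> ?h = ?h \<otimes> g" using g h c by (metis group_commutes_pow)
  have sh: "S ?h (?h \<otimes> h) = S \<one> h" using S_shift hm h by blast
  have "\<bar>ip ?h (?h \<otimes> h) \<one> (\<one> \<otimes> ?h)\<bar> \<le> m * S \<one> h" "\<bar>ip ?h (?h \<otimes> h) ?a (?a \<otimes> ?h)\<bar> \<le> m * S \<one> h"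
    by (rule ip_chain; use hm h sh in simp)+
  moreover have "ip ?h (?h \<otimes> h) (?a \<otimes> ?h) ?a = - ip ?h (?h \<otimes> h) ?a (?a \<otimes> ?h)"
    by (simp add: ip_def field_simps)
  moreover have "\<one> \<otimes> ?h = ?h" using hm by simp
  ultimately have "\<bar>progress g k (?h \<otimes> h) - progress g k ?h - progress g k h\<bar> \<le> 2 * m * S \<one> h"
    using progress_split[OF g hm(1) h cm, of k] by simp
  then have "\<bar>progress g k (?h \<otimes> h) - Suc m * progress g k h\<bar> \<le> (real m ^ 2 + 2 * m) * S \<one> h"
    using Suc by (simp add: algebra_simps)
  also have "\<dots> \<le> real (Suc m) ^ 2 * S \<one> h"
    using S_nonneg[of \<one> h] h by (intro mult_right_mono) (auto simp: power2_eq_square algebra_simps)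
  finally show ?case by simp
qed

text \<open>Compare \<open>h\<close> with \<open>h ^ m\<close>, where \<open>k = 2 ^ (i + b)\<close> and \<open>m = 2 ^ b\<close>. The progress of \<open>h ^ m\<close> involves the
distance of \<open>h ^ m\<close> and \<open>g ^ k\<close>, which is at least the square root of the drift of
\<open>h ^ (- m) g ^ k\<close>; the parallelogram law evaluates that drift. The error is small when first
\<open>m / k = 2 ^ (- i)\<close> is small and then \<open>b\<close> is large.\<close>
lemma progress_upper:
  assumes g: "g \<in> carrier G" and h: "h \<in> carrier G" and c: "g \<otimes> h = h \<otimes> g"
  shows "progress g (2 ^ (i + b)) h / 2 ^ (i + b) \<le> form g h + 2 * S \<one> h / 2 ^ i
      + 2 ^ i * (S \<one> (g [^] (2 ^ (i + b) :: nat)) / 4 ^ (i + b) - drift g)"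
proof -
  define k m :: nat where "k = 2 ^ (i + b)" and "m = 2 ^ b"
  define C where "C = S \<one> h"
  have C0: "0 \<le> C" using S_nonneg h by (simp add: C_def)
  let ?a = "g [^] k" and ?h = "h [^] m"
  have ah: "?a \<in> carrier G" "?h \<in> carrier G" using g h by auto
  have comm: "?a \<otimes> ?h = ?h \<otimes> ?a" using c g h by (metis group_commutes_pow nat_pow_closed)
  have mm: "real m ^ 2 = 4 ^ b" "real k ^ 2 = 4 ^ (i + b)"
    by (simp_all add: m_def k_def power2_eq_square power_mult_distrib[symmetric])
  have form_ah: "form ?a ?h = real k * real m * form g h"
  proof -
    have "g \<otimes> ?h = ?h \<otimes> g" using c g h by (metis group_commutes_pow)
    then have "form ?a ?h = real k * form g ?h"
      unfolding k_def using form_pow_left[of g ?h] g ah by simp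
    also have "form g ?h = form ?h g" using \<open>g \<otimes> ?h = ?h \<otimes> g\<close> by (rule form_sym)
    also have "\<dots> = real m * form h g" unfolding m_def using form_pow_left[of h g] c g h by simp
    finally show ?thesis using form_sym[OF c] by simp
  qed
  have "S ?h ?a \<ge> drift (inv ?h \<otimes> ?a)"
  proof -
    have "S ?h ?a = S \<one> (inv ?h \<otimes> ?a)"
      using S_left[of ?h \<one> "inv ?h \<otimes> ?a"] ah by (simp add: m_assoc[symmetric])
    then show ?thesis using drift_le ah by simp
  qed
  moreover have "drift (inv ?h \<otimes> ?a) = drift ?a + drift ?h - 2 * form ?a ?h"
    using parallelogram[of ?h ?a] comm ah by (simp add: form_def field_simps)
  moreover have "drift ?a = real k ^ 2 * drift g" "drift ?h = real m ^ 2 * drift h"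
    unfolding mm using drift_pow2 g h by (simp_all add: k_def m_def)
  moreover have "S \<one> ?h \<le> real m ^ 2 * C"
    unfolding mm C_def using S_pow_le[OF h, of b] by (simp add: m_def)
  moreover have "progress g k ?h = (S \<one> ?a + S \<one> ?h - S ?h ?a) / 2"
    using S_refl[of \<one>] S_sym[of ?h \<one>] ah by (simp add: progress_def ip_def)
  moreover have "m * progress g k h \<le> progress g k ?h + real m ^ 2 * C"
    using progress_pow_bound[OF assms, of k m] by (simp add: C_def)
  moreover have "0 \<le> real m ^ 2 * drift h" using drift_nonneg h by simp
  moreover have "0 \<le> real m ^ 2 * C" using C0 by simp
  moreover have "real k ^ 2 * drift g \<le> S \<one> ?a"
    using drift_le[of ?a] ah calculation(3) by simp
  ultimately have main: "m * progress g k h \<le> 2 * (real m ^ 2 * C) + real k * real m * form g h + (S \<one> ?a - real k ^ 2 * drift g)"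
    using form_ah by simp
  have k: "real k = 2 ^ i * real m" "0 < real m" by (simp_all add: k_def m_def power_add)
  have "progress g k h / k = m * progress g k h / (m * k)" using k by simp
  also have "\<dots> \<le> (2 * (real m ^ 2 * C) + real k * real m * form g h + (S \<one> ?a - real k ^ 2 * drift g)) / (m * k)"
    using main k by (intro divide_right_mono) auto
  also have "\<dots> = form g h + 2 * C / 2 ^ i + 2 ^ i * (S \<one> ?a / real k ^ 2 - drift g)"
    using k by (simp add: field_simps power2_eq_square)
  finally show ?thesis unfolding mm C_def by (simp add: k_def)
qed

lemma progress_upper_eventually:
  assumes g: "g \<in> carrier G" and h: "h \<in> carrier G" and c: "g \<otimes> h = h \<otimes> g" and e: "0 < e"
  shows "eventually (\<lambda>j. progress g (2 ^ j) h / 2 ^ j < form g h + e) sequentially"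
proof -
  have "(\<lambda>i. 2 * S \<one> h / 2 ^ i) \<longlonglongrightarrow> 0" by real_asymp
  then have "eventually (\<lambda>i. 2 * S \<one> h / 2 ^ i < e / 2) sequentially"
    using e by (intro order_tendstoD) auto
  then obtain i where i: "2 * S \<one> h / 2 ^ i < e / 2" by (auto simp: eventually_sequentially)
  have "(\<lambda>j. 2 ^ i * (S \<one> (g [^] (2 ^ j :: nat)) / 4 ^ j - drift g)) \<longlonglongrightarrow> 2 ^ i * (drift g - drift g)"
    by (intro tendsto_intros drift_lim g)
  then have "eventually (\<lambda>j. 2 ^ i * (S \<one> (g [^] (2 ^ j :: nat)) / 4 ^ j - drift g) < e / 2) sequentially"
    by (rule order_tendstoD(2)) (use e in simp)
  moreover have "eventually (\<lambda>j. j \<ge> i) sequentially" by (rule eventually_ge_at_top)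
  ultimately show ?thesis
  proof eventually_elim
    case (elim j)
    then obtain b where "j = i + b" using le_Suc_ex by blast
    then show ?case using progress_upper[OF g h c, of i b] elim(1) i unfolding \<open>j = i + b\<close> by linarith
  qed
qed

text \<open>The upper bound for \<open>inv h\<close> is the lower bound for \<open>h\<close>, up to the bounded defect of additivity.\<close>
lemma progress_lim:
  assumes g: "g \<in> carrier G" and h: "h \<in> carrier G" and c: "g \<otimes> h = h \<otimes> g"
  shows "(\<lambda>j. progress g (2 ^ j) h / 2 ^ j) \<longlonglongrightarrow> form g h"
proof (rule order_tendstoI)
  fix a assume "form g h < a"
  then show "eventually (\<lambda>j. progress g (2 ^ j) h / 2 ^ j < a) sequentially"
    using progress_upper_eventually[OF assms, of "a - form g h"] by simp
next
  fix a assume a: "a < form g h"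
  have c': "g \<otimes> inv h = inv h \<otimes> g" using inv_commute[of h g] g h c by simp
  define e where "e = (form g h - a) / 2"
  have e: "e > 0" using a by (simp add: e_def)
  have "eventually (\<lambda>j. progress g (2 ^ j) (inv h) / 2 ^ j < - form g h + e) sequentially"
    using progress_upper_eventually[OF g _ c' e] form_inv_right[OF assms] h by simp
  moreover have "(\<lambda>j. (S \<one> h + S \<one> (inv h)) / 2 ^ j) \<longlonglongrightarrow> 0" by real_asymp
  then have "eventually (\<lambda>j. (S \<one> h + S \<one> (inv h)) / 2 ^ j < e) sequentially"
    using e by (intro order_tendstoD) auto
  ultimately show "eventually (\<lambda>j. a < progress g (2 ^ j) h / 2 ^ j) sequentially"
  proof eventually_elim
    case (elim j)
    have "progress g (2 ^ j) (h \<otimes> inv h) = 0" using g h S_refl by (simp add: progress_def ip_def)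
    then have "- progress g (2 ^ j) h \<le> progress g (2 ^ j) (inv h) + (S \<one> h + S \<one> (inv h))"
      using progress_add_bound[OF g h _ c, of "inv h" "2 ^ j"] h by simp
    then have "- (progress g (2 ^ j) h / 2 ^ j) \<le> progress g (2 ^ j) (inv h) / 2 ^ j + (S \<one> h + S \<one> (inv h)) / 2 ^ j"
      unfolding add_divide_distrib[symmetric] minus_divide_left by (intro divide_right_mono) auto
    moreover have "2 * e = form g h - a" by (simp add: e_def)
    ultimately show ?case using elim by linarith
  qed
qed

lemma form_add:
  assumes g: "g \<in> carrier G" and h: "h \<in> carrier G" "h' \<in> carrier G"
    and c: "g \<otimes> h = h \<otimes> g" "g \<otimes> h' = h' \<otimes> g"
  shows "form g (h \<otimes> h') = form g h + form g h'"
proof -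
  have c2: "g \<otimes> (h \<otimes> h') = h \<otimes> h' \<otimes> g" using g h c by (metis m_assoc)
  let ?d = "\<lambda>j. progress g (2 ^ j) (h \<otimes> h') / 2 ^ j - progress g (2 ^ j) h / 2 ^ j - progress g (2 ^ j) h' / 2 ^ j"
  have "?d \<longlonglongrightarrow> form g (h \<otimes> h') - form g h - form g h'"
    by (intro tendsto_diff progress_lim) (use g h c c2 in auto)
  moreover have "?d \<longlonglongrightarrow> 0"
  proof (rule Lim_null_comparison)
    show "(\<lambda>j. (S \<one> h + S \<one> h') / 2 ^ j) \<longlonglongrightarrow> 0" by real_asymp
    show "eventually (\<lambda>j. norm (?d j) \<le> (S \<one> h + S \<one> h') / 2 ^ j) sequentially"
      using progress_add_bound[OF g h c(1)]
      by (auto simp: diff_divide_distrib[symmetric] abs_divide divide_right_mono)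
  qed
  ultimately show ?thesis using LIMSEQ_unique by fastforce
qed

text \<open>A real-valued homomorphism kills commutators: the relation makes \<open>z\<close> a commutator of \<open>x\<close> and \<open>y\<close>
in the centraliser of \<open>g\<close>.\<close>
lemma form_relation_zero:
  assumes "g \<in> carrier G" "x \<in> carrier G" "y \<in> carrier G" "z \<in> carrier G"
    and "g \<otimes> x = x \<otimes> g" "g \<otimes> y = y \<otimes> g" "g \<otimes> z = z \<otimes> g"
    and rel: "x \<otimes> y = y \<otimes> z \<otimes> x"
  shows "form g z = 0"
proof -
  have c: "g \<otimes> (y \<otimes> z) = y \<otimes> z \<otimes> g" using assms(1-7) by (metis m_assoc)
  have "form g (x \<otimes> y) = form g x + form g y" by (rule form_add) (use assms in auto)
  moreover have "form g (y \<otimes> z \<otimes> x) = form g (y \<otimes> z) + form g x" by (rule form_add) (use assms c in auto)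
  moreover have "form g (y \<otimes> z) = form g y + form g z" by (rule form_add) (use assms in auto)
  ultimately show ?thesis using rel by simp
qed

text \<open>The parallelogram law makes the drift of \<open>g ^ m\<close> satisfy a linear recursion in \<open>m\<close>.\<close>
lemma drift_pow_zero:
  assumes g: "g \<in> carrier G" and "drift g = 0"
  shows "drift (g [^] (p::int)) = 0"
proof -
  have *: "drift (g [^] (m::nat)) = 0 \<and> drift (g [^] Suc m) = 0" for m
  proof (induction m)
    case 0
    then show ?case using assms drift_one by simp
  next
    case (Suc m)
    have Suc_l: "g [^] Suc m = g \<otimes> g [^] m" using g by (rule nat_pow_Suc2)
    have "g \<otimes> g [^] Suc m = g [^] Suc m \<otimes> g" by (rule trans[OF nat_pow_Suc2[OF g, symmetric] nat_pow_Suc])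
    moreover have "inv g \<otimes> g [^] Suc m = g [^] m" unfolding Suc_l using g by (simp add: cancel_inv_left)
    moreover have "g \<otimes> g [^] Suc m = g [^] Suc (Suc m)" using g by (simp only: nat_pow_Suc2[symmetric])
    ultimately
    have "drift (g [^] Suc (Suc m)) + drift (g [^] m) = 2 * drift g + 2 * drift (g [^] Suc m)"
      using parallelogram[of g "g [^] Suc m"] g by (simp only: nat_pow_closed)
    then show ?case using Suc assms by simp
  qed
  have nat_zero: "drift (g [^] (m::nat)) = 0" for m using * by blast
  have "drift (inv (g [^] (m::nat))) = 0" for m
    unfolding drift_inv[OF nat_pow_closed[OF g]] by (rule nat_zero)
  then show ?thesis unfolding int_pow_def2 using nat_zero by (cases "p < 0") (simp_all only: if_True if_False)
qed

end

section \<open>Induction from a subgroup of finite index\<close>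

text \<open>The kernel of the induced action on the product of copies of the space, one for each right coset of
\<open>H\<close>. Here \<open>\<kappa>\<close> is an \<open>H\<close>-equivariant map of the group to \<open>H\<close>, so
\<open>\<kappa> (x \<otimes> a)\<close>, with \<open>x\<close> running over coset representatives, are the coordinates of the translate
of the base point by \<open>a\<close>. Each summand depends on the coset of \<open>x\<close> only, and right multiplication
permutes the cosets, whence left invariance. The coordinate of the coset \<open>H\<close> recovers the kernel
on \<open>H\<close> based at \<open>y = \<kappa> \<one>\<close>.\<close>
lemma (in group) induced_kernel:
  assumes H: "subgroup H G" and fin: "finite (rcosets H)"
    and K: "round_kernel (G\<lparr>carrier := H\<rparr>) S"
  shows "\<exists>T. round_kernel G T \<and> (\<exists>y\<in>H. \<forall>h\<in>H. S y (h \<otimes> y) \<le> T \<one> h)"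
proof -
  interpret H: subgroup H G by (rule H)
  interpret K: round_kernel "G\<lparr>carrier := H\<rparr>" S by (rule K)
  note K_simps = K.S_nonneg[simplified] K.S_refl[simplified] K.S_left[simplified]
  define rep where "rep C = (SOME x. x \<in> C)" for C :: "'a set"
  define \<kappa> where "\<kappa> x = x \<otimes> inv (rep (H #> x))" for x
  have rep: "rep (H #> x) \<in> H #> x" if "x \<in> carrier G" for x
    unfolding rep_def by (rule someI[of _ x]) (use rcos_self[OF that H] in simp)
  have \<kappa>_mem: "\<kappa> x \<in> H" if x: "x \<in> carrier G" for x
  proof -
    obtain h where h: "h \<in> H" "rep (H #> x) = h \<otimes> x"
      using rep[OF x] by (auto simp: r_coset_def)
    then have "\<kappa> x = inv h" using x by (simp add: \<kappa>_def inv_mult_group m_assoc[symmetric])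
    then show ?thesis using h by simp
  qed
  have \<kappa>_mult: "\<kappa> (h \<otimes> x) = h \<otimes> \<kappa> x" if h: "h \<in> H" and x: "x \<in> carrier G" for h x
  proof -
    have "H #> (h \<otimes> x) = H #> x"
      using coset_mult_assoc[of H h x] H.subset h x H.rcos_const[OF group_axioms h] by simp
    moreover have "rep (H #> x) \<in> carrier G"
      using rep[OF x] r_coset_subset_G[OF H.subset x] by blast
    ultimately show ?thesis using h x by (simp add: \<kappa>_def m_assoc)
  qed
  define t where "t x a b = S (\<kappa> (x \<otimes> a)) (\<kappa> (x \<otimes> b))" for x a b
  have t_coset: "t y a b = t x a b"
    if x: "x \<in> carrier G" and y: "y \<in> H #> x" and ab: "a \<in> carrier G" "b \<in> carrier G" for x y a b
  proof -
    obtain h where h: "h \<in> H" "y = h \<otimes> x" using y by (auto simp: r_coset_def)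
    then show ?thesis
      using x ab by (simp add: t_def m_assoc \<kappa>_mult \<kappa>_mem K_simps)
  qed
  define T where "T a b = (\<Sum>C \<in> rcosets H. t (rep C) a b)" for a b
  have rep_C: "rep C \<in> C" "rep C \<in> carrier G" "C = H #> rep C" if "C \<in> rcosets H" for C
  proof -
    obtain x where x: "x \<in> carrier G" "C = H #> x" using \<open>C \<in> rcosets H\<close> by (auto simp: RCOSETS_def)
    then show "rep C \<in> C" "rep C \<in> carrier G" "C = H #> rep C"
      using rep[OF x(1)] r_coset_subset_G[OF H.subset x(1)] repr_independence[OF _ x(1) H] by auto
  qed
  note closed = rep_C(2) \<kappa>_mem m_closed
  have "round_kernel G T"
  proof unfold_locales
    fix c a b assume cab: "c \<in> carrier G" "a \<in> carrier G" "b \<in> carrier G"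
    have "bij_betw (\<lambda>C. C #> c) (rcosets H) (rcosets H)"
    proof (rule bij_betw_byWitness[where f' = "\<lambda>C. C #> inv c"])
      have *: "C #> d \<in> rcosets H" if "C \<in> rcosets H" "d \<in> carrier G" for C d
        using that rcosetsI[OF H.subset, of "rep C \<otimes> d"] rep_C(2,3)[OF that(1)]
          coset_mult_assoc[OF H.subset, of "rep C" d] by simp
      then show "(\<lambda>C. C #> c) ` (rcosets H) \<subseteq> rcosets H" "(\<lambda>C. C #> inv c) ` (rcosets H) \<subseteq> rcosets H"
        using cab by auto
      have "C \<subseteq> carrier G" if "C \<in> rcosets H" for C
        using that rcosets_part_G[OF H] by blast
      then show "\<forall>C\<in>rcosets H. C #> c #> inv c = C" "\<forall>C\<in>rcosets H. C #> inv c #> c = C"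
        using cab by (simp_all add: coset_mult_assoc)
    qed
    from sum.reindex_bij_betw[OF this, of "\<lambda>C. t (rep C) a b"]
    have "T a b = (\<Sum>C \<in> rcosets H. t (rep (C #> c)) a b)" by (simp add: T_def)
    also have "\<dots> = (\<Sum>C \<in> rcosets H. t (rep C) (c \<otimes> a) (c \<otimes> b))"
    proof (rule sum.cong[OF refl])
      fix C assume C: "C \<in> rcosets H"
      note r = rep_C[OF C]
      have "C #> c = H #> (rep C \<otimes> c)" using r cab coset_mult_assoc[OF H.subset, of "rep C" c] by simp
      then have "rep (C #> c) \<in> H #> (rep C \<otimes> c)" using rep[of "rep C \<otimes> c"] r cab by simp
      then have "t (rep (C #> c)) a b = t (rep C \<otimes> c) a b" using t_coset r cab by simp
      then show "t (rep (C #> c)) a b = t (rep C) (c \<otimes> a) (c \<otimes> b)"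
        using r cab by (simp add: t_def m_assoc)
    qed
    finally show "T (c \<otimes> a) (c \<otimes> b) = T a b" by (simp add: T_def)
  next
    fix p q r s assume "p \<in> carrier G" "q \<in> carrier G" "r \<in> carrier G" "s \<in> carrier G"
    then show "T p r + T q s \<le> T p q + T q r + T r s + T s p"
      unfolding T_def t_def sum.distrib[symmetric]
      by (intro sum_mono K.S_round[simplified] closed)
  next
    fix a b assume ab: "a \<in> carrier G" "b \<in> carrier G"
    then show "0 \<le> T a b" unfolding T_def t_def by (intro sum_nonneg K.S_nonneg[simplified] closed)
    show "T a b = T b a" unfolding T_def t_def
      by (intro sum.cong refl K.S_sym[simplified] closed) (use ab in auto)
  next
    fix a assume "a \<in> carrier G"
    then show "T a a = 0" unfolding T_def t_def by (intro sum.neutral ballI K.S_refl[simplified] closed)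
  qed
  moreover have "S (\<kappa> \<one>) (h \<otimes> \<kappa> \<one>) \<le> T \<one> h" if h: "h \<in> H" for h
  proof -
    have HC: "H \<in> rcosets H" using rcosetsI[OF H.subset one_closed] H.subset by (simp add: coset_mult_one)
    then have "rep H \<in> H #> \<one>" using rep_C(1) H.subset by (simp add: coset_mult_one)
    then have "t (rep H) \<one> h = S (\<kappa> \<one>) (h \<otimes> \<kappa> \<one>)"
      using t_coset[of \<one> "rep H" \<one> h] \<kappa>_mult[OF h one_closed] h by (simp add: t_def)
    moreover have "t (rep H) \<one> h \<le> T \<one> h"
      unfolding T_def
    proof (rule member_le_sum[OF HC _ fin])
      fix C assume "C \<in> rcosets H - {H}"
      then show "0 \<le> t (rep C) \<one> h" unfolding t_def by (intro K.S_nonneg[simplified] closed) (use h in auto)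
    qed
    ultimately show ?thesis by simp
  qed
  ultimately show ?thesis using \<kappa>_mem[OF one_closed] by blast
qed

section \<open>Nielsen transformations have speed zero\<close>

context
  fixes n :: nat and Fr :: "letter list monoid" and A :: "(letter list \<Rightarrow> letter list) monoid"
  defines "Fr \<equiv> free_group n" and "A \<equiv> AutoGroup (free_group n)"
begin

interpretation Fr: group Fr unfolding Fr_def by (rule group_free_group)

interpretation A: group A unfolding A_def by (rule group.AutoGroup[OF group_free_group])

lemma basis_carrier: "k \<in> {1..n} \<Longrightarrow> basis k \<in> carrier Fr"
  unfolding Fr_def by (rule basis_closed)

lemma aut_hom: "\<phi> \<in> carrier A \<Longrightarrow> \<phi> \<in> hom Fr Fr"
  and aut_Bij: "\<phi> \<in> carrier A \<Longrightarrow> \<phi> \<in> Bij (carrier Fr)"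
  by (simp_all add: A_def Fr_def AutoGroup_def auto_def)

lemma aut_closed: "\<lbrakk>\<phi> \<in> carrier A; x \<in> carrier Fr\<rbrakk> \<Longrightarrow> \<phi> x \<in> carrier Fr"
  using aut_hom[of \<phi>] by (auto simp: hom_def)

lemma aut_mult: "\<lbrakk>\<phi> \<in> carrier A; x \<in> carrier Fr; y \<in> carrier Fr\<rbrakk> \<Longrightarrow> \<phi> (x \<otimes>\<^bsub>Fr\<^esub> y) = \<phi> x \<otimes>\<^bsub>Fr\<^esub> \<phi> y"
  using aut_hom[of \<phi>] by (auto simp: hom_def)

lemma aut_inv: "\<lbrakk>\<phi> \<in> carrier A; x \<in> carrier Fr\<rbrakk> \<Longrightarrow> \<phi> (inv\<^bsub>Fr\<^esub> x) = inv\<^bsub>Fr\<^esub> (\<phi> x)"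
  using group_hom.hom_inv[of Fr Fr \<phi> x] aut_hom Fr.group_axioms
  by (simp add: group_hom_def group_hom_axioms_def)

lemma aut_comp:
  assumes "\<phi> \<in> carrier A" "\<psi> \<in> carrier A" "x \<in> carrier Fr"
  shows "(\<phi> \<otimes>\<^bsub>A\<^esub> \<psi>) x = \<phi> (\<psi> x)"
  using aut_Bij[OF assms(1)] aut_Bij[OF assms(2)] assms(3)
  by (simp add: A_def Fr_def AutoGroup_def BijGroup_def compose_eq)

lemma aut_eqI:
  assumes \<phi>: "\<phi> \<in> carrier A" and \<psi>: "\<psi> \<in> carrier A"
    and eq: "\<And>k. k \<in> {1..n} \<Longrightarrow> \<phi> (basis k) = \<psi> (basis k)"
  shows "\<phi> = \<psi>"
proof
  fix w
  have e: "\<phi> \<in> extensional (carrier Fr)" "\<psi> \<in> extensional (carrier Fr)"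
    using aut_Bij[OF \<phi>] aut_Bij[OF \<psi>] by (simp_all add: Bij_def)
  show "\<phi> w = \<psi> w"
  proof (cases "w \<in> carrier Fr")
    case True
    have cl: "\<And>k. k \<in> {1..n} \<Longrightarrow> \<psi> (basis k) \<in> carrier Fr"
      using aut_closed[OF \<psi>] basis_carrier by simp
    have "\<phi> w = free_ext Fr (\<lambda>k. \<psi> (basis k)) w"
      by (rule free_ext_unique[OF Fr.group_axioms cl]) (use aut_hom[OF \<phi>] True eq in \<open>simp_all add: Fr_def\<close>)
    moreover have "\<psi> w = free_ext Fr (\<lambda>k. \<psi> (basis k)) w"
      by (rule free_ext_unique[OF Fr.group_axioms cl]) (use aut_hom[OF \<psi>] True in \<open>simp_all add: Fr_def\<close>)
    ultimately show ?thesis by simp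
  next
    case False
    then show ?thesis using e by (simp add: extensional_def)
  qed
qed

abbreviation (input) "lam \<equiv> nielsen_left n"
abbreviation (input) "rho \<equiv> nielsen_right n"

lemma nielsen_carrier:
  assumes "i \<in> {1..n}" "j \<in> {1..n}" "i \<noteq> j"
  shows lam_carrier: "lam i j \<in> carrier A" and rho_carrier: "rho i j \<in> carrier A"
proof -
  have "lam i j \<in> nielsen_transformations n" "rho i j \<in> nielsen_transformations n"
    unfolding nielsen_transformations_def using assms by blast+
  then show "lam i j \<in> carrier A" "rho i j \<in> carrier A"
    using nielsen_transformations_auto[of n] by (auto simp: A_def AutoGroup_def)
qed

lemma lam_basis:
  assumes "i \<in> {1..n}" "j \<in> {1..n}" "k \<in> {1..n}"
  shows "lam i j (basis k) = (if k = i then basis j \<otimes>\<^bsub>Fr\<^esub> basis i else basis k)"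
proof -
  have "free_ext Fr (basis(i := basis j \<otimes>\<^bsub>Fr\<^esub> basis i)) (basis k) = (basis(i := basis j \<otimes>\<^bsub>Fr\<^esub> basis i)) k"
    by (rule free_ext_basis[OF Fr.group_axioms _ assms(3)]) (use assms basis_carrier in auto)
  then show ?thesis using assms basis_carrier by (simp add: nielsen_left_def Fr_def)
qed

lemma rho_basis:
  assumes "i \<in> {1..n}" "j \<in> {1..n}" "k \<in> {1..n}"
  shows "rho i j (basis k) = (if k = i then basis i \<otimes>\<^bsub>Fr\<^esub> basis j else basis k)"
proof -
  have "free_ext Fr (basis(i := basis i \<otimes>\<^bsub>Fr\<^esub> basis j)) (basis k) = (basis(i := basis i \<otimes>\<^bsub>Fr\<^esub> basis j)) k"
    by (rule free_ext_basis[OF Fr.group_axioms _ assms(3)]) (use assms basis_carrier in auto)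
  then show ?thesis using assms basis_carrier by (simp add: nielsen_right_def Fr_def)
qed

lemmas aut_rules = aut_closed aut_mult aut_comp lam_basis rho_basis lam_carrier rho_carrier
  basis_carrier Fr.m_assoc Fr.m_closed A.m_closed

lemma lam_rho_commute:
  assumes "i \<in> {1..n}" "j \<in> {1..n}" "k \<in> {1..n}" "l \<in> {1..n}" "i \<noteq> j" "k \<noteq> l" "k \<noteq> j" "l \<noteq> i"
  shows "lam i j \<otimes>\<^bsub>A\<^esub> rho k l = rho k l \<otimes>\<^bsub>A\<^esub> lam i j"
  by (rule aut_eqI) (use assms in \<open>auto simp: aut_rules\<close>)

lemma lam_commute:
  assumes "i \<in> {1..n}" "j \<in> {1..n}" "k \<in> {1..n}" "l \<in> {1..n}" "i \<noteq> j" "k \<noteq> l" "k \<noteq> j" "l \<noteq> i" "k \<noteq> i"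
  shows "lam i j \<otimes>\<^bsub>A\<^esub> lam k l = lam k l \<otimes>\<^bsub>A\<^esub> lam i j"
  by (rule aut_eqI) (use assms in \<open>auto simp: aut_rules\<close>)

lemma rho_commute:
  assumes "i \<in> {1..n}" "j \<in> {1..n}" "k \<in> {1..n}" "l \<in> {1..n}" "i \<noteq> j" "k \<noteq> l" "k \<noteq> j" "l \<noteq> i" "k \<noteq> i"
  shows "rho i j \<otimes>\<^bsub>A\<^esub> rho k l = rho k l \<otimes>\<^bsub>A\<^esub> rho i j"
  by (rule aut_eqI) (use assms in \<open>auto simp: aut_rules\<close>)

text \<open>These relations exhibit a Nielsen transformation as a commutator of two others through an auxiliary
index \<open>l\<close>.\<close>
lemma lam_relation:
  assumes "k \<in> {1..n}" "l \<in> {1..n}" "j \<in> {1..n}" "k \<noteq> l" "l \<noteq> j" "k \<noteq> j"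
  shows "lam l j \<otimes>\<^bsub>A\<^esub> lam k l = lam k l \<otimes>\<^bsub>A\<^esub> lam k j \<otimes>\<^bsub>A\<^esub> lam l j"
  by (rule aut_eqI) (use assms in \<open>auto simp: aut_rules\<close>)

lemma rho_relation:
  assumes "k \<in> {1..n}" "l \<in> {1..n}" "j \<in> {1..n}" "k \<noteq> l" "l \<noteq> j" "k \<noteq> j"
  shows "rho l j \<otimes>\<^bsub>A\<^esub> rho k l = rho k l \<otimes>\<^bsub>A\<^esub> rho k j \<otimes>\<^bsub>A\<^esub> rho l j"
  by (rule aut_eqI) (use assms in \<open>auto simp: aut_rules\<close>)

definition ad :: "nat \<Rightarrow> letter list \<Rightarrow> letter list" where
  "ad j = restrict (\<lambda>x. basis j \<otimes>\<^bsub>Fr\<^esub> x \<otimes>\<^bsub>Fr\<^esub> inv\<^bsub>Fr\<^esub> (basis j)) (carrier Fr)"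

lemma ad_carrier:
  assumes j: "j \<in> {1..n}"
  shows "ad j \<in> carrier A"
proof -
  let ?b = "basis j"
  note b = basis_carrier[OF j]
  have bij: "bij_betw (ad j) (carrier Fr) (carrier Fr)"
    unfolding ad_def bij_betw_restrict_eq
    by (rule bij_betw_byWitness[where f' = "\<lambda>x. inv\<^bsub>Fr\<^esub> ?b \<otimes>\<^bsub>Fr\<^esub> x \<otimes>\<^bsub>Fr\<^esub> ?b"])
      (use b in \<open>auto simp: Fr.m_assoc Fr.cancel_inv_left Fr.cancel_left_inv\<close>)
  have "?b \<otimes>\<^bsub>Fr\<^esub> (x \<otimes>\<^bsub>Fr\<^esub> y) \<otimes>\<^bsub>Fr\<^esub> inv\<^bsub>Fr\<^esub> ?b
    = ?b \<otimes>\<^bsub>Fr\<^esub> x \<otimes>\<^bsub>Fr\<^esub> inv\<^bsub>Fr\<^esub> ?b \<otimes>\<^bsub>Fr\<^esub> (?b \<otimes>\<^bsub>Fr\<^esub> y \<otimes>\<^bsub>Fr\<^esub> inv\<^bsub>Fr\<^esub> ?b)"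
    if "x \<in> carrier Fr" "y \<in> carrier Fr" for x y
  proof -
    have "inv\<^bsub>Fr\<^esub> ?b \<otimes>\<^bsub>Fr\<^esub> (?b \<otimes>\<^bsub>Fr\<^esub> (y \<otimes>\<^bsub>Fr\<^esub> inv\<^bsub>Fr\<^esub> ?b)) = y \<otimes>\<^bsub>Fr\<^esub> inv\<^bsub>Fr\<^esub> ?b"
      using that b by (simp add: Fr.m_assoc[symmetric])
    then show ?thesis using that b by (simp add: Fr.m_assoc)
  qed
  then have "ad j \<in> hom Fr Fr" using b by (auto simp: hom_def ad_def)
  then show ?thesis using bij by (simp add: A_def AutoGroup_def auto_def Bij_def Fr_def[symmetric]) (simp add: ad_def)
qed

lemma ad_commute:
  assumes j: "j \<in> {1..n}" and \<phi>: "\<phi> \<in> carrier A" "\<phi> (basis j) = basis j"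
  shows "ad j \<otimes>\<^bsub>A\<^esub> \<phi> = \<phi> \<otimes>\<^bsub>A\<^esub> ad j"
  by (rule aut_eqI) (use assms ad_carrier[OF j] in \<open>auto simp: aut_rules aut_inv ad_def\<close>)

text \<open>The simultaneous transvections (multiply all \<open>a\<^sub>k\<close>, \<open>k \<in> C\<close>, by \<open>a\<^sub>j\<close> on one side) are products of
Nielsen transformations that commute with \<open>g\<close>; the form against \<open>g\<close> is therefore a sum.\<close>
lemma commuting_product:
  assumes K: "round_kernel A S"
    and g: "g \<in> carrier A"
    and \<nu>: "\<And>k. k \<in> C \<Longrightarrow> \<nu> k \<in> carrier A" "\<And>k. k \<in> C \<Longrightarrow> g \<otimes>\<^bsub>A\<^esub> \<nu> k = \<nu> k \<otimes>\<^bsub>A\<^esub> g"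
    and val: "\<And>k l. k \<in> C \<Longrightarrow> l \<in> {1..n} \<Longrightarrow> \<nu> k (basis l) = (if l = k then t k else basis l)"
    and fix_t: "\<And>k l. k \<in> C \<Longrightarrow> l \<in> C \<Longrightarrow> k \<noteq> l \<Longrightarrow> \<nu> k (t l) = t l"
    and C: "finite C" "C \<subseteq> {1..n}"
  shows "\<exists>\<Lambda> \<in> carrier A. g \<otimes>\<^bsub>A\<^esub> \<Lambda> = \<Lambda> \<otimes>\<^bsub>A\<^esub> g \<and>
    (\<forall>l\<in>{1..n}. \<Lambda> (basis l) = (if l \<in> C then t l else basis l)) \<and>
    round_kernel.form A S g \<Lambda> = (\<Sum>k\<in>C. round_kernel.form A S g (\<nu> k))"
  using C(1) C(2) \<nu> val fix_t
proof (induction C rule: finite_induct)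
  case empty
  interpret K: round_kernel A S by (rule K)
  have "\<one>\<^bsub>A\<^esub> (basis l) = basis l" if "l \<in> {1..n}" for l
    using basis_carrier[OF that] by (simp add: A_def AutoGroup_def BijGroup_def Fr_def)
  moreover have "K.form g \<one>\<^bsub>A\<^esub> = 0" using g K.drift_one by (simp add: K.form_def)
  ultimately show ?case using g by (intro bexI[of _ "\<one>\<^bsub>A\<^esub>"]) auto
next
  case (insert k C)
  interpret K: round_kernel A S by (rule K)
  have "\<exists>\<Lambda> \<in> carrier A. g \<otimes>\<^bsub>A\<^esub> \<Lambda> = \<Lambda> \<otimes>\<^bsub>A\<^esub> g \<and>
    (\<forall>l\<in>{1..n}. \<Lambda> (basis l) = (if l \<in> C then t l else basis l)) \<and> K.form g \<Lambda> = (\<Sum>k\<in>C. K.form g (\<nu> k))"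
    by (rule insert.IH) (use insert.prems in auto)
  then obtain \<Lambda> where \<Lambda>: "\<Lambda> \<in> carrier A" "g \<otimes>\<^bsub>A\<^esub> \<Lambda> = \<Lambda> \<otimes>\<^bsub>A\<^esub> g"
    "\<And>l. l \<in> {1..n} \<Longrightarrow> \<Lambda> (basis l) = (if l \<in> C then t l else basis l)"
    "K.form g \<Lambda> = (\<Sum>k\<in>C. K.form g (\<nu> k))" by blast
  have k: "\<nu> k \<in> carrier A" "g \<otimes>\<^bsub>A\<^esub> \<nu> k = \<nu> k \<otimes>\<^bsub>A\<^esub> g" using insert.prems(2,3) by auto
  show ?case
  proof (intro bexI conjI ballI)
    show "\<nu> k \<otimes>\<^bsub>A\<^esub> \<Lambda> \<in> carrier A" using k \<Lambda> by simp
    show "g \<otimes>\<^bsub>A\<^esub> (\<nu> k \<otimes>\<^bsub>A\<^esub> \<Lambda>) = \<nu> k \<otimes>\<^bsub>A\<^esub> \<Lambda> \<otimes>\<^bsub>A\<^esub> g"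
      unfolding A.m_assoc[OF k(1) \<Lambda>(1) g] \<Lambda>(2)[symmetric]
      using k(1) \<Lambda>(1) g by (simp add: A.m_assoc[symmetric] k(2))
    show "K.form g (\<nu> k \<otimes>\<^bsub>A\<^esub> \<Lambda>) = (\<Sum>k\<in>insert k C. K.form g (\<nu> k))"
      using K.form_add[OF g k(1) \<Lambda>(1) k(2) \<Lambda>(2)] \<Lambda>(4) insert.hyps by simp
    fix l assume l: "l \<in> {1..n}"
    have "(\<nu> k \<otimes>\<^bsub>A\<^esub> \<Lambda>) (basis l) = \<nu> k (\<Lambda> (basis l))"
      by (rule aut_comp[OF k(1) \<Lambda>(1) basis_carrier[OF l]])
    then show "(\<nu> k \<otimes>\<^bsub>A\<^esub> \<Lambda>) (basis l) = (if l \<in> insert k C then t l else basis l)"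
      using \<Lambda>(3)[OF l] insert.prems(4)[of k l] insert.prems(5)[of k l] insert.hyps(2) l by auto
  qed
qed

text \<open>Conjugation by \<open>a\<^sub>j\<close> turns \<open>a\<^sub>l a\<^sub>j\<close> into \<open>a\<^sub>j a\<^sub>l\<close>.\<close>
lemma ad_product:
  assumes j: "j \<in> {1..n}" and L: "L \<in> carrier A" and R: "R \<in> carrier A"
    and valL: "\<And>l. l \<in> {1..n} \<Longrightarrow> L (basis l) = (if l \<in> {1..n} - {j} then basis j \<otimes>\<^bsub>Fr\<^esub> basis l else basis l)"
    and valR: "\<And>l. l \<in> {1..n} \<Longrightarrow> R (basis l) = (if l \<in> {1..n} - {j} then basis l \<otimes>\<^bsub>Fr\<^esub> basis j else basis l)"
  shows "ad j \<otimes>\<^bsub>A\<^esub> R = L"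
proof (rule aut_eqI)
  fix l assume l: "l \<in> {1..n}"
  note b = basis_carrier[OF j] basis_carrier[OF l]
  have "(ad j \<otimes>\<^bsub>A\<^esub> R) (basis l) = ad j (R (basis l))" by (rule aut_comp[OF ad_carrier[OF j] R b(2)])
  also have "\<dots> = L (basis l)"
  proof (cases "l = j")
    case True
    then show ?thesis using valL[OF l] valR[OF l] b by (simp add: ad_def Fr.m_assoc)
  next
    case False
    then show ?thesis using valL[OF l] valR[OF l] b l by (simp add: ad_def Fr.m_assoc)
  qed
  finally show "(ad j \<otimes>\<^bsub>A\<^esub> R) (basis l) = L (basis l)" .
qed (use L R ad_carrier[OF j] in auto)

text \<open>Pair \<open>g = lam i j\<close> with both sides of \<open>ad j \<otimes> R = L\<close>, where \<open>L\<close> and \<open>R\<close> are the products of all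
\<open>lam k j\<close> and of all \<open>rho k j\<close>. With the relations above, everything orthogonal to \<open>g\<close> drops out:
\<open>lam k j\<close> for \<open>k \<noteq> i\<close> and \<open>rho k j\<close> for all \<open>k\<close> are commutators inside the centraliser of \<open>g\<close>, and
\<open>g\<close> is a commutator inside the centraliser of \<open>ad j\<close>. What remains is \<open>drift g = 0\<close>. The same
computation applies to \<open>rho i j\<close>. The hypothesis \<open>n \<ge> 4\<close> provides an index \<open>l\<close> different from \<open>i\<close>,
\<open>j\<close> and \<open>k\<close>.\<close>
theorem nielsen_drift_zero:
  assumes K: "round_kernel A S" and n: "n \<ge> 4"
    and i: "i \<in> {1..n}" and j: "j \<in> {1..n}" and ij: "i \<noteq> j"
  shows "round_kernel.drift A S (lam i j) = 0 \<and> round_kernel.drift A S (rho i j) = 0"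
proof -
  interpret K: round_kernel A S by (rule K)
  let ?C = "{1..n} - {j}"
  have fresh: "\<exists>l\<in>{1..n}. l \<noteq> i \<and> l \<noteq> j \<and> l \<noteq> k" for k
  proof (rule ccontr)
    assume "\<not> ?thesis"
    then have "{1..n} \<subseteq> {i, j, k}" by auto
    then have "card {1..n} \<le> card {i, j, k}" by (intro card_mono) auto
    also have "\<dots> \<le> 3" by (simp add: card_insert_if)
    finally show False using n by simp
  qed
  have lam_lam: "K.form (lam i j) (lam k j) = 0" if k: "k \<in> {1..n}" "k \<noteq> j" "k \<noteq> i" for k
  proof -
    obtain l where l: "l \<in> {1..n}" "l \<noteq> i" "l \<noteq> j" "l \<noteq> k" using fresh by blast
    show ?thesis
      by (rule K.form_relation_zero[OF lam_carrier[OF i j ij] lam_carrier[OF l(1) j l(3)]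
          lam_carrier[OF k(1) l(1) l(4)[symmetric]] lam_carrier[OF k(1) j k(2)]
          lam_commute[OF i j l(1) j ij l(3) l(3) ij[symmetric] l(2)]
          lam_commute[OF i j k(1) l(1) ij l(4)[symmetric] k(2) l(2) k(3)]
          lam_commute[OF i j k(1) j ij k(2) k(2) ij[symmetric] k(3)]
          lam_relation[OF k(1) l(1) j l(4)[symmetric] l(3) k(2)]])
  qed
  have rho_rho: "K.form (rho i j) (rho k j) = 0" if k: "k \<in> {1..n}" "k \<noteq> j" "k \<noteq> i" for k
  proof -
    obtain l where l: "l \<in> {1..n}" "l \<noteq> i" "l \<noteq> j" "l \<noteq> k" using fresh by blast
    show ?thesis
      by (rule K.form_relation_zero[OF rho_carrier[OF i j ij] rho_carrier[OF l(1) j l(3)]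
          rho_carrier[OF k(1) l(1) l(4)[symmetric]] rho_carrier[OF k(1) j k(2)]
          rho_commute[OF i j l(1) j ij l(3) l(3) ij[symmetric] l(2)]
          rho_commute[OF i j k(1) l(1) ij l(4)[symmetric] k(2) l(2) k(3)]
          rho_commute[OF i j k(1) j ij k(2) k(2) ij[symmetric] k(3)]
          rho_relation[OF k(1) l(1) j l(4)[symmetric] l(3) k(2)]])
  qed
  have lam_rho: "K.form (lam i j) (rho k j) = 0" if k: "k \<in> {1..n}" "k \<noteq> j" for k
  proof -
    obtain l where l: "l \<in> {1..n}" "l \<noteq> i" "l \<noteq> j" "l \<noteq> k" using fresh by blast
    show ?thesis
      by (rule K.form_relation_zero[OF lam_carrier[OF i j ij] rho_carrier[OF l(1) j l(3)]
          rho_carrier[OF k(1) l(1) l(4)[symmetric]] rho_carrier[OF k(1) j k(2)]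
          lam_rho_commute[OF i j l(1) j ij l(3) l(3) ij[symmetric]]
          lam_rho_commute[OF i j k(1) l(1) ij l(4)[symmetric] k(2) l(2)]
          lam_rho_commute[OF i j k(1) j ij k(2) k(2) ij[symmetric]]
          rho_relation[OF k(1) l(1) j l(4)[symmetric] l(3) k(2)]])
  qed
  have rho_lam: "K.form (rho i j) (lam k j) = 0" if k: "k \<in> {1..n}" "k \<noteq> j" for k
  proof -
    obtain l where l: "l \<in> {1..n}" "l \<noteq> i" "l \<noteq> j" "l \<noteq> k" using fresh by blast
    show ?thesis
      by (rule K.form_relation_zero[OF rho_carrier[OF i j ij] lam_carrier[OF l(1) j l(3)]
          lam_carrier[OF k(1) l(1) l(4)[symmetric]] lam_carrier[OF k(1) j k(2)]
          lam_rho_commute[OF l(1) j i j l(3) ij ij l(3)[symmetric], symmetric]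
          lam_rho_commute[OF k(1) l(1) i j l(4)[symmetric] ij l(2)[symmetric] k(2)[symmetric], symmetric]
          lam_rho_commute[OF k(1) j i j k(2) ij ij k(2)[symmetric], symmetric]
          lam_relation[OF k(1) l(1) j l(4)[symmetric] l(3) k(2)]])
  qed
  have ad_zero: "K.form (ad j) (lam i j) = 0" "K.form (ad j) (rho i j) = 0"
  proof -
    obtain l where l: "l \<in> {1..n}" "l \<noteq> i" "l \<noteq> j" using fresh by blast
    have fixed: "lam p q (basis j) = basis j" "rho p q (basis j) = basis j"
      if "p \<in> {1..n}" "q \<in> {1..n}" "p \<noteq> j" for p q
      using lam_basis[OF that(1,2) j] rho_basis[OF that(1,2) j] that(3) by simp_all
    show "K.form (ad j) (lam i j) = 0"
      by (rule K.form_relation_zero[OF ad_carrier[OF j]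
          lam_carrier[OF l(1) j l(3)]
          lam_carrier[OF i l(1) l(2)[symmetric]]
          lam_carrier[OF i j ij]
          ad_commute[OF j lam_carrier[OF l(1) j l(3)] fixed(1)[OF l(1) j l(3)]]
          ad_commute[OF j lam_carrier[OF i l(1) l(2)[symmetric]] fixed(1)[OF i l(1) ij]]
          ad_commute[OF j lam_carrier[OF i j ij] fixed(1)[OF i j ij]]
          lam_relation[OF i l(1) j l(2)[symmetric] l(3) ij]])
    show "K.form (ad j) (rho i j) = 0"
      by (rule K.form_relation_zero[OF ad_carrier[OF j]
          rho_carrier[OF l(1) j l(3)]
          rho_carrier[OF i l(1) l(2)[symmetric]]
          rho_carrier[OF i j ij]
          ad_commute[OF j rho_carrier[OF l(1) j l(3)] fixed(2)[OF l(1) j l(3)]]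
          ad_commute[OF j rho_carrier[OF i l(1) l(2)[symmetric]] fixed(2)[OF i l(1) ij]]
          ad_commute[OF j rho_carrier[OF i j ij] fixed(2)[OF i j ij]]
          rho_relation[OF i l(1) j l(2)[symmetric] l(3) ij]])
  qed
  have main: "(\<Sum>k\<in>?C. K.form g (lam k j)) = (\<Sum>k\<in>?C. K.form g (rho k j))"
    if g: "g \<in> carrier A" "g (basis j) = basis j" and ad0: "K.form (ad j) g = 0"
      and gl: "\<And>k. k \<in> ?C \<Longrightarrow> g \<otimes>\<^bsub>A\<^esub> lam k j = lam k j \<otimes>\<^bsub>A\<^esub> g"
      and gr: "\<And>k. k \<in> ?C \<Longrightarrow> g \<otimes>\<^bsub>A\<^esub> rho k j = rho k j \<otimes>\<^bsub>A\<^esub> g" for g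
  proof -
    have "\<exists>L \<in> carrier A. g \<otimes>\<^bsub>A\<^esub> L = L \<otimes>\<^bsub>A\<^esub> g \<and>
      (\<forall>l\<in>{1..n}. L (basis l) = (if l \<in> ?C then basis j \<otimes>\<^bsub>Fr\<^esub> basis l else basis l)) \<and>
      K.form g L = (\<Sum>k\<in>?C. K.form g (lam k j))"
      by (rule commuting_product[OF K g(1)])
        (use j gl in \<open>auto simp: lam_carrier lam_basis aut_mult basis_carrier\<close>)
    then obtain L where L: "L \<in> carrier A" "g \<otimes>\<^bsub>A\<^esub> L = L \<otimes>\<^bsub>A\<^esub> g"
      "\<And>l. l \<in> {1..n} \<Longrightarrow> L (basis l) = (if l \<in> ?C then basis j \<otimes>\<^bsub>Fr\<^esub> basis l else basis l)"
      "K.form g L = (\<Sum>k\<in>?C. K.form g (lam k j))" by blast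
    have "\<exists>R \<in> carrier A. g \<otimes>\<^bsub>A\<^esub> R = R \<otimes>\<^bsub>A\<^esub> g \<and>
      (\<forall>l\<in>{1..n}. R (basis l) = (if l \<in> ?C then basis l \<otimes>\<^bsub>Fr\<^esub> basis j else basis l)) \<and>
      K.form g R = (\<Sum>k\<in>?C. K.form g (rho k j))"
      by (rule commuting_product[OF K g(1)])
        (use j gr in \<open>auto simp: rho_carrier rho_basis aut_mult basis_carrier\<close>)
    then obtain R where R: "R \<in> carrier A" "g \<otimes>\<^bsub>A\<^esub> R = R \<otimes>\<^bsub>A\<^esub> g"
      "\<And>l. l \<in> {1..n} \<Longrightarrow> R (basis l) = (if l \<in> ?C then basis l \<otimes>\<^bsub>Fr\<^esub> basis j else basis l)"
      "K.form g R = (\<Sum>k\<in>?C. K.form g (rho k j))" by blast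
    have comm: "g \<otimes>\<^bsub>A\<^esub> ad j = ad j \<otimes>\<^bsub>A\<^esub> g" using ad_commute[OF j g] by simp
    have prod: "ad j \<otimes>\<^bsub>A\<^esub> R = L" by (rule ad_product[OF j L(1) R(1) L(3) R(3)])
    have "K.form g L = K.form g (ad j) + K.form g R"
      using K.form_add[OF g(1) ad_carrier[OF j] R(1) comm R(2)] unfolding prod .
    also have "K.form g (ad j) = 0" using K.form_sym[OF comm] ad0 by simp
    finally show ?thesis using L(4) R(4) by simp
  qed
  have iC: "i \<in> ?C" using i ij by simp
  have "(\<Sum>k\<in>?C. K.form (lam i j) (lam k j)) = K.form (lam i j) (lam i j)"
    using lam_lam by (subst sum.remove[OF _ iC]) auto
  moreover have "(\<Sum>k\<in>?C. K.form (lam i j) (rho k j)) = 0" using lam_rho by (intro sum.neutral) auto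
  moreover have "(\<Sum>k\<in>?C. K.form (lam i j) (lam k j)) = (\<Sum>k\<in>?C. K.form (lam i j) (rho k j))"
  proof (rule main[OF lam_carrier[OF i j ij] _ ad_zero(1)])
    show "lam i j (basis j) = basis j" using lam_basis[OF i j j] ij by simp
    fix k assume k: "k \<in> ?C"
    show "lam i j \<otimes>\<^bsub>A\<^esub> lam k j = lam k j \<otimes>\<^bsub>A\<^esub> lam i j"
    proof (cases "k = i")
      case False
      then show ?thesis using k lam_commute[OF i j _ j ij _ _ ij[symmetric] False] by simp
    qed simp
    show "lam i j \<otimes>\<^bsub>A\<^esub> rho k j = rho k j \<otimes>\<^bsub>A\<^esub> lam i j"
      using k lam_rho_commute[OF i j _ j ij _ _ ij[symmetric]] by simp
  qed
  ultimately have "K.drift (lam i j) = 0" using K.form_self[OF lam_carrier[OF i j ij]] by simp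
  have "(\<Sum>k\<in>?C. K.form (rho i j) (rho k j)) = K.form (rho i j) (rho i j)"
    using rho_rho by (subst sum.remove[OF _ iC]) auto
  moreover have "(\<Sum>k\<in>?C. K.form (rho i j) (lam k j)) = 0" using rho_lam by (intro sum.neutral) auto
  moreover have "(\<Sum>k\<in>?C. K.form (rho i j) (lam k j)) = (\<Sum>k\<in>?C. K.form (rho i j) (rho k j))"
  proof (rule main[OF rho_carrier[OF i j ij] _ ad_zero(2)])
    show "rho i j (basis j) = basis j" using rho_basis[OF i j j] ij by simp
    fix k assume k: "k \<in> ?C"
    show "rho i j \<otimes>\<^bsub>A\<^esub> rho k j = rho k j \<otimes>\<^bsub>A\<^esub> rho i j"
    proof (cases "k = i")
      case False
      then show ?thesis using k rho_commute[OF i j _ j ij _ _ ij[symmetric] False] by simp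
    qed simp
    show "rho i j \<otimes>\<^bsub>A\<^esub> lam k j = lam k j \<otimes>\<^bsub>A\<^esub> rho i j"
      using k lam_rho_commute[OF _ j i j _ ij ij] by simp
  qed
  ultimately have "K.drift (rho i j) = 0" using K.form_self[OF rho_carrier[OF i j ij]] by simp
  with \<open>K.drift (lam i j) = 0\<close> show ?thesis by simp
qed

end

section \<open>Squared distances and translation lengths in CAT(0) spaces\<close>

lemma comparison_triangle:
  fixes a b c :: real
  assumes "0 \<le> a" "0 \<le> b" "0 \<le> c" "a \<le> b + c" "b \<le> c + a" "c \<le> a + b"
  shows "\<exists>p q r :: real^2. dist p q = a \<and> dist q r = b \<and> dist r p = c"
proof (cases "a = 0")
  case True
  let ?q = "vector [0, 0] :: real^2" and ?r = "vector [b, 0] :: real^2"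
  have "b = c" using assms True by simp
  then show ?thesis using assms True
    by (intro exI[of _ ?q] exI[of _ ?r]) (simp add: dist_vec_def L2_set_def sum_2 dist_real_def)
next
  case False
  then have a: "a > 0" using assms by simp
  define x where "x = (a\<^sup>2 + c\<^sup>2 - b\<^sup>2) / (2 * a)"
  have ax: "2 * a * x = a\<^sup>2 + c\<^sup>2 - b\<^sup>2" using a by (simp add: x_def)
  have up: "2 * a * x \<le> 2 * a * c"
  proof -
    have "(a - c)\<^sup>2 \<le> b\<^sup>2" using assms by (intro abs_le_square_iff[THEN iffD1]) (simp add: abs_le_iff)
    then show ?thesis unfolding ax by (simp add: power2_diff)
  qed
  have lo: "2 * a * (- c) \<le> 2 * a * x"
  proof -
    have "b\<^sup>2 \<le> (a + c)\<^sup>2" using assms by (intro power_mono) auto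
    then show ?thesis unfolding ax by (simp add: power2_sum)
  qed
  have "x \<le> c" by (rule mult_left_le_imp_le[OF up]) (use a in simp)
  moreover have "- c \<le> x" by (rule mult_left_le_imp_le[OF lo]) (use a in simp)
  ultimately have "\<bar>x\<bar> \<le> \<bar>c\<bar>" by linarith
  then have x: "x\<^sup>2 \<le> c\<^sup>2" by (simp add: abs_le_square_iff)
  define y where "y = sqrt (c\<^sup>2 - x\<^sup>2)"
  have y: "y\<^sup>2 = c\<^sup>2 - x\<^sup>2" using x by (simp add: y_def)
  let ?p = "vector [0, 0] :: real^2" and ?q = "vector [a, 0] :: real^2" and ?r = "vector [x, y] :: real^2"
  have "dist ?p ?q = a" using a by (simp add: dist_vec_def L2_set_def sum_2 dist_real_def)
  moreover have "(a - x)\<^sup>2 + y\<^sup>2 = b\<^sup>2" using ax y by (simp add: power2_diff)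
  then have "dist ?q ?r = b"
    using assms by (simp add: dist_vec_def L2_set_def sum_2 dist_real_def)
  moreover have "dist ?r ?p = c"
    using assms y by (simp add: dist_vec_def L2_set_def sum_2 dist_real_def)
  ultimately show ?thesis by blast
qed

lemma median_length:
  fixes u v :: "'b::real_inner"
  shows "(norm ((1/2) *\<^sub>R (u + v)))\<^sup>2 = (norm u)\<^sup>2 / 2 + (norm v)\<^sup>2 / 2 - (norm (v - u))\<^sup>2 / 4"
  unfolding power2_norm_eq_inner
  by (simp add: inner_add_left inner_add_right inner_diff_left inner_diff_right inner_commute[of v u] field_simps)

lemma geodesic_segment_right_end: "geodesic_segment S p q \<Longrightarrow> q \<in> S"
  unfolding geodesic_segment_def by force

text \<open>The Bruhat-Tits inequality: compare with the median of a Euclidean comparison triangle.\<close>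
lemma CAT0_midpoint:
  fixes p q :: "'x::metric_space"
  assumes X: "CAT0 TYPE('x)"
  shows "\<exists>m. dist p m = dist p q / 2 \<and> dist q m = dist p q / 2 \<and>
    (\<forall>r. (dist r m)\<^sup>2 \<le> (dist r p)\<^sup>2 / 2 + (dist r q)\<^sup>2 / 2 - (dist p q)\<^sup>2 / 4)"
proof -
  have geod: "\<exists>S. geodesic_segment S a b" for a b :: 'x using X by (simp add: CAT0_def)
  obtain A where A: "geodesic_segment A p q" using geod by blast
  then obtain c l where c: "0 \<le> l" "c 0 = p" "c l = q" "A = c ` {0..l}"
    "\<And>s t. s \<in> {0..l} \<Longrightarrow> t \<in> {0..l} \<Longrightarrow> dist (c s) (c t) = \<bar>s - t\<bar>"
    unfolding geodesic_segment_def by blast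
  define m where "m = c (l / 2)"
  have l: "dist p q = l" using c(5)[of 0 l] c by simp
  have m: "m \<in> A" "dist p m = l / 2" "dist q m = l / 2"
    using c(5)[of 0 "l / 2"] c(5)[of l "l / 2"] c by (auto simp: m_def)
  have "(dist r m)\<^sup>2 \<le> (dist r p)\<^sup>2 / 2 + (dist r q)\<^sup>2 / 2 - (dist p q)\<^sup>2 / 4" for r
  proof -
    obtain B C where BC: "geodesic_segment B q r" "geodesic_segment C r p" using geod by blast
    obtain p' q' r' :: "real^2" where t: "dist p' q' = dist p q" "dist q' r' = dist q r" "dist r' p' = dist r p"
      using comparison_triangle[of "dist p q" "dist q r" "dist r p"]
        dist_triangle[of p q r] dist_triangle[of q r p] dist_triangle[of r p q]
      by (auto simp: dist_commute add.commute)
    let ?m = "midpoint p' q'"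
    have "comparison_on_side A p p' q' m ?m"
      using m l t by (simp add: comparison_on_side_def midpoint_in_closed_segment dist_midpoint)
    moreover have "comparison_on_side B q q' r' r r'"
      using geodesic_segment_right_end[OF BC(1)] t by (simp add: comparison_on_side_def)
    ultimately have "dist m r \<le> dist ?m r'"
      using X A BC t unfolding CAT0_def by blast
    then have "(dist r m)\<^sup>2 \<le> (dist r' ?m)\<^sup>2" by (simp add: dist_commute power_mono)
    also have "(dist r' ?m)\<^sup>2 = (dist r' p')\<^sup>2 / 2 + (dist r' q')\<^sup>2 / 2 - (dist p' q')\<^sup>2 / 4"
    proof -
      have *: "r' - ?m = (1/2) *\<^sub>R ((r' - p') + (r' - q'))" "p' - q' = (r' - q') - (r' - p')"
        by (simp_all add: midpoint_def algebra_simps scaleR_2[symmetric])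
      show ?thesis unfolding dist_norm * by (rule median_length)
    qed
    finally show ?thesis using t by (simp add: dist_commute)
  qed
  then show ?thesis using m l by (intro exI[of _ m]) simp
qed

text \<open>Apply the Bruhat-Tits inequality at \<open>q\<close> and \<open>s\<close> to the midpoint of the diagonal \<open>pr\<close>; the other
diagonal is at most the length of the path through that midpoint.\<close>
lemma CAT0_quadrilateral:
  fixes p q r s :: "'x::metric_space"
  assumes X: "CAT0 TYPE('x)"
  shows "(dist p r)\<^sup>2 + (dist q s)\<^sup>2 \<le> (dist p q)\<^sup>2 + (dist q r)\<^sup>2 + (dist r s)\<^sup>2 + (dist s p)\<^sup>2"
proof -
  obtain m where m: "\<forall>x. (dist x m)\<^sup>2 \<le> (dist x p)\<^sup>2 / 2 + (dist x r)\<^sup>2 / 2 - (dist p r)\<^sup>2 / 4"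
    using CAT0_midpoint[OF X, of p r] by blast
  have "(dist q s)\<^sup>2 \<le> (dist q m + dist s m)\<^sup>2"
    by (rule power_mono[OF dist_triangle2 zero_le_dist])
  also have "\<dots> \<le> 2 * (dist q m)\<^sup>2 + 2 * (dist s m)\<^sup>2"
    using sum_squares_bound[of "dist q m" "dist s m"] by (simp add: power2_sum)
  finally show ?thesis using spec[OF m, of q] spec[OF m, of s] by (simp add: dist_commute)
qed

lemma translation_length_nonneg: "0 \<le> translation_length \<gamma>"
  and translation_length_le: "translation_length \<gamma> \<le> dist x (\<gamma> x)"
proof -
  show "0 \<le> translation_length \<gamma>" unfolding translation_length_def by (rule cINF_greatest) auto
  have "bdd_below (range (\<lambda>x. dist x (\<gamma> x)))" by (rule bdd_belowI[of _ 0]) auto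
  then show "translation_length \<gamma> \<le> dist x (\<gamma> x)" unfolding translation_length_def
    by (rule cINF_lower) simp
qed

text \<open>If \<open>m\<close> is the midpoint of \<open>y\<close> and \<open>\<gamma> y\<close>, then \<open>m\<close> and \<open>\<gamma> m\<close> are the midpoints of two sides of the
triangle \<open>y, \<gamma> y, \<gamma> (\<gamma> y)\<close>, so they are at most half the third side apart.\<close>
lemma translation_length_square:
  fixes \<gamma> :: "'x::metric_space \<Rightarrow> 'x"
  assumes X: "CAT0 TYPE('x)" and \<gamma>: "isometry \<gamma>"
  shows "2 * translation_length \<gamma> \<le> translation_length (\<gamma> \<circ> \<gamma>)"
proof -
  have iso: "dist (\<gamma> x) (\<gamma> y) = dist x y" for x y using \<gamma> by (simp add: isometry_def)
  have "2 * translation_length \<gamma> \<le> dist y ((\<gamma> \<circ> \<gamma>) y)" for y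
  proof -
    \<comment> \<open>The preimage of \<open>y\<close> turns distances from \<open>\<gamma> m\<close> into distances from \<open>m\<close>, where the
      Bruhat-Tits inequality is available.\<close>
    have "surj \<gamma>" using \<gamma> by (simp add: isometry_def bij_def)
    then obtain x where x: "\<gamma> x = y" using surjD by metis
    obtain m where m: "dist y m = dist y (\<gamma> y) / 2" "dist (\<gamma> y) m = dist y (\<gamma> y) / 2"
      "\<forall>r. (dist r m)\<^sup>2 \<le> (dist r y)\<^sup>2 / 2 + (dist r (\<gamma> y))\<^sup>2 / 2 - (dist y (\<gamma> y))\<^sup>2 / 4"
      using CAT0_midpoint[OF X, of y "\<gamma> y"] by blast
    have "dist x y = dist y (\<gamma> y)" "dist x (\<gamma> y) = dist y (\<gamma> (\<gamma> y))" "dist x m = dist y (\<gamma> m)"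
      using iso[of x y] iso[of x "\<gamma> y"] iso[of x m] x by simp_all
    then have "(dist y (\<gamma> m))\<^sup>2 \<le> (dist y (\<gamma> y))\<^sup>2 / 4 + (dist y (\<gamma> (\<gamma> y)))\<^sup>2 / 2"
      using spec[OF m(3), of x] by simp
    moreover have step: "dist (\<gamma> m) (\<gamma> y) = dist y (\<gamma> y) / 2"
      using iso[of m y] m(1) by (simp only: dist_commute)
    have "(dist (\<gamma> m) (\<gamma> y))\<^sup>2 = (dist y (\<gamma> y))\<^sup>2 / 4"
      unfolding step by (simp add: power_divide)
    ultimately have "(dist (\<gamma> m) m)\<^sup>2 \<le> (dist y (\<gamma> (\<gamma> y)))\<^sup>2 / 4"
      using spec[OF m(3), of "\<gamma> m"] by (simp only: dist_commute[of "\<gamma> m" y])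
    then have "(dist m (\<gamma> m))\<^sup>2 \<le> (dist y (\<gamma> (\<gamma> y)))\<^sup>2 / 4" by (simp only: dist_commute)
    then have "(2 * dist m (\<gamma> m))\<^sup>2 \<le> (dist y (\<gamma> (\<gamma> y)))\<^sup>2" by (simp add: power_mult_distrib)
    then have "2 * dist m (\<gamma> m) \<le> dist y (\<gamma> (\<gamma> y))" by (rule power2_le_imp_le) simp
    then show ?thesis using translation_length_le[of \<gamma> m] by simp
  qed
  then show ?thesis unfolding translation_length_def[of "\<gamma> \<circ> \<gamma>"] by (intro cINF_greatest) auto
qed

section \<open>Real characters of abelian groups\<close>

text \<open>Choose a subgroup \<open>M\<close> maximal among those that contain no nontrivial power of \<open>z\<close>. Modulo \<open>M\<close>, every
\<open>x\<close> has a positive power that is a power of \<open>z\<close>, for otherwise \<open>M\<close> could be enlarged by \<open>x\<close>. The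
quotient of the two exponents is the value of the character at \<open>x\<close>.\<close>
lemma (in comm_group) exists_real_character:
  assumes z: "z \<in> carrier G" and inf: "\<And>m::nat. m > 0 \<Longrightarrow> z [^] m \<noteq> \<one>"
  shows "\<exists>\<eta> :: 'a \<Rightarrow> real. (\<forall>x\<in>carrier G. \<forall>y\<in>carrier G. \<eta> (x \<otimes> y) = \<eta> x + \<eta> y) \<and> \<eta> z = 1"
proof -
  have z0: "l = 0" if "z [^] (l::int) = \<one>" for l
  proof (rule ccontr)
    assume "l \<noteq> 0"
    moreover have "z [^] \<bar>l\<bar> = \<one>"
      using that int_pow_neg[OF z, of l] by (cases "l < 0") simp_all
    then have "z [^] nat \<bar>l\<bar> = \<one>" using int_pow_int[of G z "nat \<bar>l\<bar>"] by simp
    ultimately show False using inf[of "nat \<bar>l\<bar>"] by simp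
  qed
  define \<A> where "\<A> = {M. subgroup M G \<and> (\<forall>l::int. z [^] l \<in> M \<longrightarrow> l = 0)}"
  have "\<exists>M\<in>\<A>. \<forall>X\<in>\<A>. M \<subseteq> X \<longrightarrow> X = M"
  proof (rule subset_Zorn_nonempty)
    have "{\<one>} \<in> \<A>" using z0 triv_subgroup by (auto simp: \<A>_def)
    then show "\<A> \<noteq> {}" by blast
  next
    fix \<C> assume ne: "\<C> \<noteq> {}" and ch: "subset.chain \<A> \<C>"
    then have sub: "\<And>M. M \<in> \<C> \<Longrightarrow> subgroup M G" "\<And>M l. M \<in> \<C> \<Longrightarrow> z [^] (l::int) \<in> M \<Longrightarrow> l = 0"
      by (auto simp: \<A>_def subset.chain_def)
    have "subgroup (\<Union>\<C>) G"
    proof (rule subgroupI)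
      show "\<Union>\<C> \<subseteq> carrier G" using sub(1) subgroup.subset by blast
      show "\<Union>\<C> \<noteq> {}" using ne sub(1) subgroup.one_closed by blast
      show "inv a \<in> \<Union>\<C>" if "a \<in> \<Union>\<C>" for a
        using that sub(1) by (auto intro: subgroup.m_inv_closed)
      fix a b assume "a \<in> \<Union>\<C>" "b \<in> \<Union>\<C>"
      then obtain M N where MN: "M \<in> \<C>" "N \<in> \<C>" "a \<in> M" "b \<in> N" by blast
      then have "M \<subseteq> N \<or> N \<subseteq> M" using ch by (auto simp: subset.chain_def)
      then have "a \<otimes> b \<in> M \<or> a \<otimes> b \<in> N"
        using MN(3,4) subgroup.m_closed[OF sub(1)[OF MN(1)]] subgroup.m_closed[OF sub(1)[OF MN(2)]]
        by (auto dest: subsetD)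
      then show "a \<otimes> b \<in> \<Union>\<C>" using MN(1,2) by auto
    qed
    then show "\<Union>\<C> \<in> \<A>" using sub(2) by (auto simp: \<A>_def)
  qed
  then obtain M where M: "subgroup M G" "\<And>l::int. z [^] l \<in> M \<Longrightarrow> l = 0"
    and max: "\<And>X. X \<in> \<A> \<Longrightarrow> M \<subseteq> X \<Longrightarrow> X = M"
    by (auto simp: \<A>_def)
  interpret M: subgroup M G by (rule M(1))
  \<comment> \<open>The relation \<open>x ^ k = z ^ (- l)\<close> modulo \<open>M\<close>.\<close>
  define R where "R x k l \<longleftrightarrow> k > 0 \<and> x [^] k \<otimes> z [^] l \<in> M" for x and k l :: int
  have R_ex: "\<exists>k l. R x k l" if x: "x \<in> carrier G" for x
  proof -
    define X where "X = {x [^] i \<otimes> m |(i::int) m. m \<in> M}"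
    have MX: "M \<subseteq> X"
    proof
      fix m assume "m \<in> M"
      then have "m = x [^] (0::int) \<otimes> m" by simp
      then show "m \<in> X" using \<open>m \<in> M\<close> unfolding X_def by blast
    qed
    have xX: "x \<in> X"
    proof -
      have "x = x [^] (1::int) \<otimes> \<one>" using x by simp
      then show ?thesis using M.one_closed unfolding X_def by blast
    qed
    have "subgroup X G"
    proof (rule subgroupI)
      show "X \<subseteq> carrier G" using x by (auto simp: X_def)
      show "X \<noteq> {}" using xX by blast
      show "inv a \<in> X" if aX: "a \<in> X" for a
      proof -
        obtain i :: int and m where a: "a = x [^] i \<otimes> m" "m \<in> M" using aX by (auto simp: X_def)
        then have "inv a = x [^] (- i) \<otimes> inv m" using x by (simp add: inv_mult int_pow_neg)
        then show ?thesis using a M.m_inv_closed unfolding X_def by blast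
      qed
      fix a b assume "a \<in> X" "b \<in> X"
      then obtain i j :: int and m m' where "a = x [^] i \<otimes> m" "b = x [^] j \<otimes> m'" and mm: "m \<in> M" "m' \<in> M"
        by (auto simp: X_def)
      then have "a \<otimes> b = x [^] (i + j) \<otimes> (m \<otimes> m')" using x by (simp add: int_pow_mult[symmetric] m_ac)
      then show "a \<otimes> b \<in> X" using mm M.m_closed unfolding X_def by blast
    qed
    show ?thesis
    proof (cases "X \<in> \<A>")
      case True
      then have "x \<in> M" using max[OF _ MX] xX by blast
      then have "R x 1 0" using x by (simp add: R_def)
      then show ?thesis by blast
    next
      case False
      then obtain l i :: int and m where l: "l \<noteq> 0" "z [^] l = x [^] i \<otimes> m" "m \<in> M"
        using \<open>subgroup X G\<close> by (auto simp: \<A>_def X_def)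
      have i: "i \<noteq> 0" using l M(2)[of l] by auto
      have "x [^] i \<otimes> z [^] (- l) = inv m" "x [^] (- i) \<otimes> z [^] l = m"
        using x z l(3) by (simp_all add: int_pow_neg l(2) inv_mult m_assoc[symmetric])
      then have "x [^] i \<otimes> z [^] (- l) \<in> M" "x [^] (- i) \<otimes> z [^] l \<in> M" using l(3) by simp_all
      then have "R x i (- l) \<or> R x (- i) l" using i by (auto simp: R_def)
      then show ?thesis by blast
    qed
  qed
  have M_pow: "y [^] (k::int) \<in> M" if "y \<in> M" for y k
    using that subgroup_int_pow_closed[OF M(1)] by blast
  have R_pow: "x [^] (k * i) \<otimes> z [^] (l * i) \<in> M" if x: "x \<in> carrier G" and "R x k l" for x k l i
  proof -
    have "(x [^] k \<otimes> z [^] l) [^] i = x [^] (k * i) \<otimes> z [^] (l * i)"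
      using x z by (simp add: int_pow_distrib int_pow_pow)
    then show ?thesis using that M_pow[of "x [^] k \<otimes> z [^] l" i] by (simp add: R_def)
  qed
  have cancel: "a \<otimes> b \<otimes> inv (a \<otimes> c) = b \<otimes> inv c"
    if "a \<in> carrier G" "b \<in> carrier G" "c \<in> carrier G" for a b c
    unfolding m_comm[OF that(1,2)] using that by (simp add: inv_mult m_assoc cancel_left_inv)
  have R_unique: "l * k' = l' * k" if x: "x \<in> carrier G" and R: "R x k l" "R x k' l'" for x k l k' l'
  proof -
    have "x [^] (k * k') \<otimes> z [^] (l * k') \<otimes> inv (x [^] (k' * k) \<otimes> z [^] (l' * k)) \<in> M"
      using R_pow[OF x R(1)] R_pow[OF x R(2)] by simp
    also have "x [^] (k * k') \<otimes> z [^] (l * k') \<otimes> inv (x [^] (k' * k) \<otimes> z [^] (l' * k))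
      = z [^] (l * k' - l' * k)"
      using x z by (simp add: mult.commute[of k' k] int_pow_diff cancel)
    finally show ?thesis using M(2) by fastforce
  qed
  have interchange: "a \<otimes> b \<otimes> (c \<otimes> d) = a \<otimes> c \<otimes> (b \<otimes> d)"
    if "a \<in> carrier G" "b \<in> carrier G" "c \<in> carrier G" "d \<in> carrier G" for a b c d
    using that by (simp add: m_ac)
  define \<eta> where "\<eta> x = (SOME c. \<exists>k l. R x k l \<and> c = - (real_of_int l / real_of_int k))" for x
  have \<eta>: "\<eta> x = - (real_of_int l / real_of_int k)" if x: "x \<in> carrier G" and R: "R x k l" for x k l
    unfolding \<eta>_def
  proof (rule some_equality)
    fix c assume "\<exists>k l. R x k l \<and> c = - (real_of_int l / real_of_int k)"
    then obtain k' l' where R': "R x k' l'" and c: "c = - (real_of_int l' / real_of_int k')" by blast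
    have "real_of_int l * real_of_int k' = real_of_int l' * real_of_int k"
      using R_unique[OF x R R'] by (metis of_int_mult)
    moreover have "k > 0" "k' > 0" using R R' by (simp_all add: R_def)
    ultimately show "c = - (real_of_int l / real_of_int k)" unfolding c by (simp add: field_simps)
  qed (use R in blast)
  have "\<eta> (x \<otimes> y) = \<eta> x + \<eta> y" if x: "x \<in> carrier G" and y: "y \<in> carrier G" for x y
  proof -
    obtain k l where R1: "R x k l" using R_ex[OF x] by blast
    obtain k' l' where R2: "R y k' l'" using R_ex[OF y] by blast
    note R = R1 R2
    then have pos: "k > 0" "k' > 0" by (simp_all add: R_def)
    have "x [^] (k * k') \<otimes> z [^] (l * k') \<otimes> (y [^] (k' * k) \<otimes> z [^] (l' * k)) \<in> M"
      using R_pow[OF x R(1)] R_pow[OF y R(2)] by simp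
    also have "x [^] (k * k') \<otimes> z [^] (l * k') \<otimes> (y [^] (k' * k) \<otimes> z [^] (l' * k))
      = (x \<otimes> y) [^] (k * k') \<otimes> z [^] (l * k' + l' * k)"
      using x y z by (simp add: int_pow_distrib mult.commute[of k' k] int_pow_mult[symmetric] interchange)
    finally have "R (x \<otimes> y) (k * k') (l * k' + l' * k)" using pos by (simp add: R_def)
    then have "\<eta> (x \<otimes> y) = - (real_of_int (l * k' + l' * k) / real_of_int (k * k'))"
      using x y by (intro \<eta>) auto
    then show ?thesis unfolding \<eta>[OF x R1] \<eta>[OF y R2] using pos by (simp add: field_simps)
  qed
  moreover have "R z 1 (- 1)" using z M.one_closed by (simp add: R_def int_pow_neg)
  then have "\<eta> z = 1" using \<eta>[OF z] by simp
  ultimately show ?thesis by blast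
qed

section \<open>Powers of Nielsen transformations in subgroups of finite index\<close>

text \<open>Both conclusions of the theorem follow from this one, for different kernels on \<open>\<Gamma>\<close>: the points
\<open>h ^ k y\<close>, where \<open>h\<close> is the given power of \<open>\<nu>\<close>, move away from \<open>y\<close> more slowly than linearly along
\<open>k = 2 ^ j\<close>.\<close>
lemma nielsen_power_no_drift:
  fixes n :: nat and \<Gamma> :: "(letter list \<Rightarrow> letter list) set"
  defines "A \<equiv> AutoGroup (free_group n)"
  assumes n: "n \<ge> 4" and \<Gamma>: "subgroup \<Gamma> A" and fin: "finite (rcosets\<^bsub>A\<^esub> \<Gamma>)"
    and K: "round_kernel (A\<lparr>carrier := \<Gamma>\<rparr>) S"
    and \<nu>: "\<nu> \<in> nielsen_transformations n" and p: "\<nu> [^]\<^bsub>A\<^esub> (p::int) \<in> \<Gamma>"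
  shows "\<exists>y\<in>\<Gamma>. (\<lambda>j. S y ((\<nu> [^]\<^bsub>A\<^esub> p) [^]\<^bsub>A\<^esub> (2 ^ j :: nat) \<otimes>\<^bsub>A\<^esub> y) / 4 ^ j) \<longlonglongrightarrow> 0"
proof -
  interpret A: group A unfolding A_def by (rule group.AutoGroup[OF group_free_group])
  interpret \<Gamma>: subgroup \<Gamma> A by (rule \<Gamma>)
  obtain T y where T: "round_kernel A T" and y: "y \<in> \<Gamma>"
    and le: "\<And>h. h \<in> \<Gamma> \<Longrightarrow> S y (h \<otimes>\<^bsub>A\<^esub> y) \<le> T \<one>\<^bsub>A\<^esub> h"
    using A.induced_kernel[OF \<Gamma> fin K] by blast
  interpret T: round_kernel A T by (rule T)
  interpret K: round_kernel "A\<lparr>carrier := \<Gamma>\<rparr>" S by (rule K)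
  obtain i j where "i \<in> {1..n}" "j \<in> {1..n}" "i \<noteq> j" "\<nu> = nielsen_left n i j \<or> \<nu> = nielsen_right n i j"
    using \<nu> unfolding nielsen_transformations_def by blast
  then have "T.drift \<nu> = 0" using nielsen_drift_zero[OF T[unfolded A_def] n] unfolding A_def by blast
  moreover have \<nu>A: "\<nu> \<in> carrier A"
    using \<nu> nielsen_transformations_auto[of n] by (auto simp: A_def AutoGroup_def)
  ultimately have Q0: "T.drift (\<nu> [^]\<^bsub>A\<^esub> p) = 0" by (intro T.drift_pow_zero)
  let ?h = "\<nu> [^]\<^bsub>A\<^esub> p"
  have pow: "?h [^]\<^bsub>A\<^esub> (k::nat) \<in> \<Gamma>" for k
    using p by (induction k) auto
  have "(\<lambda>j. S y (?h [^]\<^bsub>A\<^esub> (2 ^ j :: nat) \<otimes>\<^bsub>A\<^esub> y) / 4 ^ j) \<longlonglongrightarrow> 0"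
  proof (rule tendsto_sandwich[where f = "\<lambda>_. 0" and h = "\<lambda>j. T \<one>\<^bsub>A\<^esub> (?h [^]\<^bsub>A\<^esub> (2 ^ j :: nat)) / 4 ^ j"])
    show "(\<lambda>j. T \<one>\<^bsub>A\<^esub> (?h [^]\<^bsub>A\<^esub> (2 ^ j :: nat)) / 4 ^ j) \<longlonglongrightarrow> 0"
      using T.drift_lim[of ?h] \<nu>A Q0 by simp
    show "\<forall>\<^sub>F j in sequentially. S y (?h [^]\<^bsub>A\<^esub> (2 ^ j :: nat) \<otimes>\<^bsub>A\<^esub> y) / 4 ^ j
        \<le> T \<one>\<^bsub>A\<^esub> (?h [^]\<^bsub>A\<^esub> (2 ^ j :: nat)) / 4 ^ j"
      by (intro always_eventually allI divide_right_mono le pow) simp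
    show "\<forall>\<^sub>F j in sequentially. 0 \<le> S y (?h [^]\<^bsub>A\<^esub> (2 ^ j :: nat) \<otimes>\<^bsub>A\<^esub> y) / 4 ^ j"
      by (intro always_eventually allI divide_nonneg_nonneg K.S_nonneg[simplified] \<Gamma>.m_closed pow y) simp
  qed simp
  then show ?thesis using y by blast
qed

lemma (in group) orbit_kernel:
  fixes \<phi> :: "'a \<Rightarrow> 'x::metric_space \<Rightarrow> 'x"
  assumes X: "CAT0 TYPE('x)" and act: "group_action G UNIV \<phi>"
    and iso: "\<And>g. g \<in> carrier G \<Longrightarrow> isometry (\<phi> g)"
  shows "round_kernel G (\<lambda>a b. (dist (\<phi> a x) (\<phi> b x))\<^sup>2)"
proof unfold_locales
  fix a b c assume "c \<in> carrier G" "a \<in> carrier G" "b \<in> carrier G"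
  then show "(dist (\<phi> (c \<otimes> a) x) (\<phi> (c \<otimes> b) x))\<^sup>2 = (dist (\<phi> a x) (\<phi> b x))\<^sup>2"
    using iso[of c] by (simp add: group_action.composition_rule[OF act] isometry_def)
next
  fix p q r s
  show "(dist (\<phi> p x) (\<phi> r x))\<^sup>2 + (dist (\<phi> q x) (\<phi> s x))\<^sup>2 \<le> (dist (\<phi> p x) (\<phi> q x))\<^sup>2 +
      (dist (\<phi> q x) (\<phi> r x))\<^sup>2 + (dist (\<phi> r x) (\<phi> s x))\<^sup>2 + (dist (\<phi> s x) (\<phi> p x))\<^sup>2"
    by (rule CAT0_quadrilateral[OF X])
qed (simp_all add: dist_commute)

lemma (in group) translation_length_power:
  fixes \<phi> :: "'a \<Rightarrow> 'x::metric_space \<Rightarrow> 'x"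
  assumes X: "CAT0 TYPE('x)" and act: "group_action G UNIV \<phi>"
    and iso: "\<And>g. g \<in> carrier G \<Longrightarrow> isometry (\<phi> g)"
    and g: "g \<in> carrier G"
  shows "2 ^ j * translation_length (\<phi> g) \<le> translation_length (\<phi> (g [^] (2 ^ j :: nat)))"
proof (induction j)
  case 0
  then show ?case using g by simp
next
  case (Suc j)
  let ?h = "g [^] (2 ^ j :: nat)"
  have h: "?h \<in> carrier G" using g by simp
  have "\<phi> (?h \<otimes> ?h) = \<phi> ?h \<circ> \<phi> ?h"
    using group_action.composition_rule[OF act _ h h] by auto
  moreover have "g [^] (2 ^ Suc j :: nat) = ?h \<otimes> ?h" using g by (simp add: nat_pow_mult mult_2)
  ultimately have sq: "\<phi> (g [^] (2 ^ Suc j :: nat)) = \<phi> ?h \<circ> \<phi> ?h" by (simp only:)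
  have "2 ^ Suc j * translation_length (\<phi> g) \<le> 2 * translation_length (\<phi> ?h)" using Suc by simp
  also have "\<dots> \<le> translation_length (\<phi> ?h \<circ> \<phi> ?h)" by (rule translation_length_square[OF X iso[OF h]])
  finally show ?case unfolding sq .
qed

text \<open>A real character is an action by translations of the line. The four-point inequality holds since the
difference of its two sides is the square of \<open>\<eta> p - \<eta> q + \<eta> r - \<eta> s\<close>.\<close>
lemma (in group) character_kernel:
  fixes \<eta> :: "'a \<Rightarrow> real"
  assumes "\<And>x y. x \<in> carrier G \<Longrightarrow> y \<in> carrier G \<Longrightarrow> \<eta> (x \<otimes> y) = \<eta> x + \<eta> y"
  shows "round_kernel G (\<lambda>a b. (\<eta> a - \<eta> b)\<^sup>2)"
proof unfold_locales
  fix p q r s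
  have "0 \<le> (\<eta> p - \<eta> q + \<eta> r - \<eta> s)\<^sup>2" by simp
  then show "(\<eta> p - \<eta> r)\<^sup>2 + (\<eta> q - \<eta> s)\<^sup>2
      \<le> (\<eta> p - \<eta> q)\<^sup>2 + (\<eta> q - \<eta> r)\<^sup>2 + (\<eta> r - \<eta> s)\<^sup>2 + (\<eta> s - \<eta> p)\<^sup>2"
    by (simp add: power2_eq_square algebra_simps)
qed (simp_all add: assms power2_commute)

text \<open>Translation lengths at least double under squaring, so sublinear growth forces translation length
zero; semisimplicity then provides a point where this infimum is attained.\<close>
lemma nielsen_power_fixes_point:
  fixes n :: nat and \<Gamma> :: "(letter list \<Rightarrow> letter list) set"
    and \<phi> :: "(letter list \<Rightarrow> letter list) \<Rightarrow> 'x::metric_space \<Rightarrow> 'x"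
  defines "A \<equiv> AutoGroup (free_group n)"
  assumes n: "n \<ge> 4" and \<Gamma>: "subgroup \<Gamma> A" and fin: "finite (rcosets\<^bsub>A\<^esub> \<Gamma>)"
    and \<nu>: "\<nu> \<in> nielsen_transformations n" and p: "\<nu> [^]\<^bsub>A\<^esub> (p::int) \<in> \<Gamma>"
    and X: "CAT0 TYPE('x)" and act: "group_action (A\<lparr>carrier := \<Gamma>\<rparr>) UNIV \<phi>"
    and ss: "\<And>g. g \<in> \<Gamma> \<Longrightarrow> semisimple (\<phi> g)"
  shows "\<exists>x. \<phi> (\<nu> [^]\<^bsub>A\<^esub> p) x = x"
proof -
  let ?G = "A\<lparr>carrier := \<Gamma>\<rparr>" and ?h = "\<nu> [^]\<^bsub>A\<^esub> p"
  interpret A: group A unfolding A_def by (rule group.AutoGroup[OF group_free_group])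
  interpret G: group ?G by (rule A.subgroup_imp_group[OF \<Gamma>])
  have iso: "\<And>g. g \<in> carrier ?G \<Longrightarrow> isometry (\<phi> g)" using ss by (simp add: semisimple_def)
  fix x0 :: 'x
  obtain y where y: "y \<in> \<Gamma>"
    and lim: "(\<lambda>j. (dist (\<phi> y x0) (\<phi> (?h [^]\<^bsub>A\<^esub> (2 ^ j :: nat) \<otimes>\<^bsub>A\<^esub> y) x0))\<^sup>2 / 4 ^ j) \<longlonglongrightarrow> 0"
    using nielsen_power_no_drift[OF n \<Gamma>[unfolded A_def] fin[unfolded A_def]
      G.orbit_kernel[OF X act iso, unfolded A_def] \<nu> p[unfolded A_def]] unfolding A_def by blast
  let ?t = "translation_length (\<phi> ?h)"
  have "?t\<^sup>2 \<le> (dist (\<phi> y x0) (\<phi> (?h [^]\<^bsub>A\<^esub> (2 ^ j :: nat) \<otimes>\<^bsub>A\<^esub> y) x0))\<^sup>2 / 4 ^ j" for j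
  proof -
    let ?k = "?h [^]\<^bsub>A\<^esub> (2 ^ j :: nat)"
    have k: "?h [^]\<^bsub>?G\<^esub> (2 ^ j :: nat) = ?k" by (rule A.nat_pow_consistent[symmetric])
    have kG: "?k \<in> \<Gamma>" using G.nat_pow_closed[of ?h "2 ^ j"] p unfolding k by simp
    have "2 ^ j * ?t \<le> translation_length (\<phi> ?k)"
      using G.translation_length_power[OF X act iso, of ?h j] p unfolding k by simp
    also have "\<dots> \<le> dist (\<phi> y x0) (\<phi> ?k (\<phi> y x0))" by (rule translation_length_le)
    also have "\<phi> ?k (\<phi> y x0) = \<phi> (?k \<otimes>\<^bsub>A\<^esub> y) x0"
      using group_action.composition_rule[OF act, of x0 ?k y] kG y by simp
    finally have "(2 ^ j * ?t)\<^sup>2 \<le> (dist (\<phi> y x0) (\<phi> (?k \<otimes>\<^bsub>A\<^esub> y) x0))\<^sup>2"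
      by (rule power_mono) (simp add: translation_length_nonneg)
    moreover have "((2::real) ^ j)\<^sup>2 = 4 ^ j" by (simp add: power2_eq_square flip: power_mult_distrib)
    ultimately have "4 ^ j * ?t\<^sup>2 \<le> (dist (\<phi> y x0) (\<phi> (?k \<otimes>\<^bsub>A\<^esub> y) x0))\<^sup>2"
      by (simp only: power_mult_distrib)
    then show ?thesis by (simp add: field_simps)
  qed
  then have "?t\<^sup>2 \<le> 0" by (intro LIMSEQ_le_const[OF lim]) blast
  then have t: "?t = 0" by simp
  obtain x where "dist x (\<phi> ?h x) = ?t" using ss[OF p] by (auto simp: semisimple_def Min_set_def)
  then show ?thesis using t by (intro exI[of _ x]) simp
qed

text \<open>Otherwise some character of \<open>\<Gamma>\<close> takes the value 1 on the element, and its powers would move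
linearly under the corresponding translations of the line.\<close>
lemma nielsen_power_finite_order:
  fixes n :: nat and \<Gamma> :: "(letter list \<Rightarrow> letter list) set"
  defines "A \<equiv> AutoGroup (free_group n)"
  assumes n: "n \<ge> 4" and \<Gamma>: "subgroup \<Gamma> A" and fin: "finite (rcosets\<^bsub>A\<^esub> \<Gamma>)"
    and \<nu>: "\<nu> \<in> nielsen_transformations n" and p: "\<nu> [^]\<^bsub>A\<^esub> (p::int) \<in> \<Gamma>"
  shows "finite_order (abelianization (A\<lparr>carrier := \<Gamma>\<rparr>))
    (abelianization_map (A\<lparr>carrier := \<Gamma>\<rparr>) (\<nu> [^]\<^bsub>A\<^esub> p))"
proof (rule ccontr)
  let ?G = "A\<lparr>carrier := \<Gamma>\<rparr>" and ?h = "\<nu> [^]\<^bsub>A\<^esub> p"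
  interpret A: group A unfolding A_def by (rule group.AutoGroup[OF group_free_group])
  interpret G: group ?G by (rule A.subgroup_imp_group[OF \<Gamma>])
  interpret N: normal "derived ?G (carrier ?G)" ?G by (rule G.derived_self_is_normal)
  interpret H: comm_group "abelianization ?G"
    unfolding abelianization_def by (rule G.derived_quot_is_comm_group)
  have hom: "abelianization_map ?G \<in> hom ?G (abelianization ?G)"
    unfolding abelianization_map_def[abs_def] abelianization_def by (rule N.r_coset_hom_Mod)
  assume "\<not> finite_order (abelianization ?G) (abelianization_map ?G ?h)"
  then have infinite: "abelianization_map ?G ?h [^]\<^bsub>abelianization ?G\<^esub> m \<noteq> \<one>\<^bsub>abelianization ?G\<^esub>"
    if "m > 0" for m :: nat
    using that unfolding finite_order_def by blast
  have "abelianization_map ?G ?h \<in> carrier (abelianization ?G)" using hom p by (auto simp: hom_def)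
  from H.exists_real_character[OF this infinite] obtain \<eta> :: "(letter list \<Rightarrow> letter list) set \<Rightarrow> real"
    where \<eta>: "\<forall>x\<in>carrier (abelianization ?G). \<forall>y\<in>carrier (abelianization ?G).
        \<eta> (x \<otimes>\<^bsub>abelianization ?G\<^esub> y) = \<eta> x + \<eta> y"
      and \<eta>1: "\<eta> (abelianization_map ?G ?h) = 1"
    by blast
  define \<theta> where "\<theta> g = \<eta> (abelianization_map ?G g)" for g
  have \<theta>: "\<theta> (x \<otimes>\<^bsub>A\<^esub> y) = \<theta> x + \<theta> y" if "x \<in> \<Gamma>" "y \<in> \<Gamma>" for x y
    using hom \<eta> that by (auto simp: \<theta>_def hom_def Pi_iff)
  have K: "round_kernel ?G (\<lambda>a b. (\<theta> a - \<theta> b)\<^sup>2)" by (rule G.character_kernel) (simp add: \<theta>)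
  obtain y where y: "y \<in> \<Gamma>"
    and lim: "(\<lambda>j. (\<theta> y - \<theta> (?h [^]\<^bsub>A\<^esub> (2 ^ j :: nat) \<otimes>\<^bsub>A\<^esub> y))\<^sup>2 / 4 ^ j) \<longlonglongrightarrow> 0"
    using nielsen_power_no_drift[OF n \<Gamma>[unfolded A_def] fin[unfolded A_def]
      K[unfolded A_def] \<nu> p[unfolded A_def]] unfolding A_def by blast
  have "?h [^]\<^bsub>A\<^esub> k \<in> \<Gamma> \<and> \<theta> (?h [^]\<^bsub>A\<^esub> k) = real k" for k :: nat
  proof (induction k)
    case 0
    have "\<theta> \<one>\<^bsub>A\<^esub> = 0" using \<theta>[of "\<one>\<^bsub>A\<^esub>" "\<one>\<^bsub>A\<^esub>"] subgroup.one_closed[OF \<Gamma>] by simp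
    then show ?case using subgroup.one_closed[OF \<Gamma>] by simp
  next
    case (Suc k)
    then show ?case using \<theta>[of "?h [^]\<^bsub>A\<^esub> k" ?h] p \<eta>1 subgroup.m_closed[OF \<Gamma>] by (simp add: \<theta>_def)
  qed
  then have "(\<theta> y - \<theta> (?h [^]\<^bsub>A\<^esub> (2 ^ j :: nat) \<otimes>\<^bsub>A\<^esub> y))\<^sup>2 / 4 ^ j = 1" for j
    using \<theta>[OF _ y] by (simp add: power2_eq_square flip: power_mult_distrib)
  with lim show False by (simp add: LIMSEQ_const_iff)
qed

theorem mainTheorem2:
  fixes n :: nat and \<Gamma> :: "(letter list \<Rightarrow> letter list) set"
  assumes "n \<ge> 4"
    and "subgroup \<Gamma> (AutoGroup (free_group n))"
    and "finite (rcosets\<^bsub>AutoGroup (free_group n)\<^esub> \<Gamma>)"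
  shows "(\<forall>\<nu> \<in> nielsen_transformations n. \<forall>p::int.
           \<nu> [^]\<^bsub>AutoGroup (free_group n)\<^esub> p \<in> \<Gamma> \<longrightarrow>
           (\<forall>\<phi> :: (letter list \<Rightarrow> letter list) \<Rightarrow> 'x::complete_space \<Rightarrow> 'x.
              CAT0 TYPE('x) \<and>
              group_action (AutoGroup (free_group n)\<lparr>carrier := \<Gamma>\<rparr>) UNIV \<phi> \<and>
              (\<forall>g\<in>\<Gamma>. semisimple (\<phi> g)) \<longrightarrow>
              (\<exists>x. \<phi> (\<nu> [^]\<^bsub>AutoGroup (free_group n)\<^esub> p) x = x))) \<and>
         (\<forall>i\<in>{1..n}. \<forall>j\<in>{1..n}. \<forall>p::int. i \<noteq> j \<longrightarrow>
           nielsen_left n i j [^]\<^bsub>AutoGroup (free_group n)\<^esub> p \<in> \<Gamma> \<longrightarrow>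
           finite_order (abelianization (AutoGroup (free_group n)\<lparr>carrier := \<Gamma>\<rparr>))
             (abelianization_map (AutoGroup (free_group n)\<lparr>carrier := \<Gamma>\<rparr>)
                (nielsen_left n i j [^]\<^bsub>AutoGroup (free_group n)\<^esub> p)))"
proof (intro conjI ballI allI impI)
  fix \<nu> p and \<phi> :: "(letter list \<Rightarrow> letter list) \<Rightarrow> 'x \<Rightarrow> 'x"
  assume "\<nu> \<in> nielsen_transformations n" "\<nu> [^]\<^bsub>AutoGroup (free_group n)\<^esub> (p::int) \<in> \<Gamma>"
    and "CAT0 TYPE('x) \<and> group_action (AutoGroup (free_group n)\<lparr>carrier := \<Gamma>\<rparr>) UNIV \<phi> \<and>
      (\<forall>g\<in>\<Gamma>. semisimple (\<phi> g))"
  then show "\<exists>x. \<phi> (\<nu> [^]\<^bsub>AutoGroup (free_group n)\<^esub> p) x = x"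
    by (intro nielsen_power_fixes_point[OF assms]) auto
next
  fix i j and p :: int
  assume "i \<in> {1..n}" "j \<in> {1..n}" "i \<noteq> j"
    and p: "nielsen_left n i j [^]\<^bsub>AutoGroup (free_group n)\<^esub> p \<in> \<Gamma>"
  then have "nielsen_left n i j \<in> nielsen_transformations n"
    unfolding nielsen_transformations_def by blast
  then show "finite_order (abelianization (AutoGroup (free_group n)\<lparr>carrier := \<Gamma>\<rparr>))
      (abelianization_map (AutoGroup (free_group n)\<lparr>carrier := \<Gamma>\<rparr>)
        (nielsen_left n i j [^]\<^bsub>AutoGroup (free_group n)\<^esub> p))"
    by (rule nielsen_power_finite_order[OF assms _ p])
qed

end
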